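(* A hemiring $R$ is primitive if and only if it is semiisomorphic to an additively cancellative hemiring $S$ whose ring of differences $D(S)$ is, in turn, isomorphic to a dense subring of linear transformations of a vector space over a division ring.
   Context: A hemiring $(R,+,\cdot,0)$ consists of a commutative monoid $(R,+,0)$ and a semigroup $(R,\cdot)$ such that multiplication distributes over addition on both sides and $0r=0=r0$ for all $r$. It is additively cancellative if $a+c=b+c$ implies $a=b$. A left $R$-semimodule is a commutative monoid $(M,+,0_M)$ with a scalar multiplication $R\times M\to M$ satisfying $(rr')m=r(r'm)$, $r(m+m')=rm+rm'$, $(r+r')m=rm+r'm$, $r0_M=0_M=0m$. It is cancellative if $x+z=y+z$ implies $x=y$, and faithful if $\{r\in R\mid rM=0\}=0$. A nonzero cancellative left $R$-semimodule $M$ is irreducible if for every pair $m_1\neq m_2$ in $M$ and every $m\in M$ there are $r_1,r_2\in R$ with $m+r_1m_1+r_2m_2=r_1m_2+r_2m_1$. A hemiring is primitive if it has a faithful irreducible left semimodule. A semiisomorphism is a surjective hemiring homomorphism $f:R\to S$ with $\{a\in R\mid f(a)=0\}=0$; $R$ is semiisomorphic to $S$ if there is a semiisomorphism $R\to S$. The ring of differences $D(S)$ of a hemiring $S$ is the factor of $S\times S$ by the congruence determined by $W=\{(s,s)\mid s\in S\}$ (that is, $(a,b)\equiv(c,d)$ iff $(a,b)+(w,w)=(c,d)+(w',w')$ for some $w,w'\in S$), with componentwise addition and multiplication $\overline{(a,b)}\,\overline{(c,d)}=\overline{(ac+bd,ad+bc)}$. When $S$ is additively cancellative, $S$ embeds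 in $D(S)$ via $s\mapsto\overline{(s,0)}$ and $D(S)=\{s-s'\mid s,s'\in S\}$. For a left vector space ${}_DM$ over a division ring $D$, linear transformations in the endomorphism ring $End({}_DM)$ are written on the right of their arguments, so that $m(rs)=(mr)s$. A subring $T\subseteq End({}_DM)$ is dense if for any linearly independent elements $m_1,\dots,m_n\in M$ and any elements $m_1',\dots,m_n'\in M$ there exists $r\in T$ such that $m_ir=m_i'$ for $i=1,\dots,n$.
   Formalization: The vector space is required to be nonzero (else R = 0 is a counterexample), and it is a right vector space with transformations acting on the left, since left spaces with right-written maps give right primitivity, which differs from left primitivity by Bergman's example. *)

theory Defs
  imports "HOL-Algebra.Module"
begin

section \<open>Hemirings and semimodules\<close>

text \<open>
  A hemiring need not have a multiplicative identity, but we use the record type of rings for its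
  notation.  The field \<open>one\<close> of a hemiring is not constrained by any notion below;
  neither are the fields \<open>mult\<close> and \<open>one\<close> of semimodules and vector spaces.
\<close>

locale hemiring = abelian_monoid R for R (structure) +
  assumes m_closed: "\<lbrakk>x \<in> carrier R; y \<in> carrier R\<rbrakk> \<Longrightarrow> x \<otimes> y \<in> carrier R"
    and m_assoc: "\<lbrakk>x \<in> carrier R; y \<in> carrier R; z \<in> carrier R\<rbrakk>
      \<Longrightarrow> (x \<otimes> y) \<otimes> z = x \<otimes> (y \<otimes> z)"
    and l_distr: "\<lbrakk>x \<in> carrier R; y \<in> carrier R; z \<in> carrier R\<rbrakk>
      \<Longrightarrow> (x \<oplus> y) \<otimes> z = x \<otimes> z \<oplus> y \<otimes> z"
    and r_distr: "\<lbrakk>x \<in> carrier R; y \<in> carrier R; z \<in> carrier R\<rbrakk>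
      \<Longrightarrow> z \<otimes> (x \<oplus> y) = z \<otimes> x \<oplus> z \<otimes> y"
    and l_null: "x \<in> carrier R \<Longrightarrow> \<zero> \<otimes> x = \<zero>"
    and r_null: "x \<in> carrier R \<Longrightarrow> x \<otimes> \<zero> = \<zero>"

definition add_cancellative :: "('a, 'c) ring_scheme \<Rightarrow> bool" where
  "add_cancellative R \<longleftrightarrow>
    (\<forall>x\<in>carrier R. \<forall>y\<in>carrier R. \<forall>z\<in>carrier R. x \<oplus>\<^bsub>R\<^esub> z = y \<oplus>\<^bsub>R\<^esub> z \<longrightarrow> x = y)"

locale left_semimodule = R?: hemiring R + M?: abelian_monoid M
  for R (structure) and M (structure) +
  assumes smult_closed: "\<lbrakk>r \<in> carrier R; m \<in> carrier M\<rbrakk> \<Longrightarrow> r \<odot>\<^bsub>M\<^esub> m \<in> carrier M"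
    and smult_assoc: "\<lbrakk>r \<in> carrier R; s \<in> carrier R; m \<in> carrier M\<rbrakk>
      \<Longrightarrow> (r \<otimes>\<^bsub>R\<^esub> s) \<odot>\<^bsub>M\<^esub> m = r \<odot>\<^bsub>M\<^esub> (s \<odot>\<^bsub>M\<^esub> m)"
    and smult_r_distr: "\<lbrakk>r \<in> carrier R; m \<in> carrier M; m' \<in> carrier M\<rbrakk>
      \<Longrightarrow> r \<odot>\<^bsub>M\<^esub> (m \<oplus>\<^bsub>M\<^esub> m') = r \<odot>\<^bsub>M\<^esub> m \<oplus>\<^bsub>M\<^esub> r \<odot>\<^bsub>M\<^esub> m'"
    and smult_l_distr: "\<lbrakk>r \<in> carrier R; s \<in> carrier R; m \<in> carrier M\<rbrakk>
      \<Longrightarrow> (r \<oplus>\<^bsub>R\<^esub> s) \<odot>\<^bsub>M\<^esub> m = r \<odot>\<^bsub>M\<^esub> m \<oplus>\<^bsub>M\<^esub> s \<odot>\<^bsub>M\<^esub> m"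
    and smult_r_null: "r \<in> carrier R \<Longrightarrow> r \<odot>\<^bsub>M\<^esub> \<zero>\<^bsub>M\<^esub> = \<zero>\<^bsub>M\<^esub>"
    and smult_l_null: "m \<in> carrier M \<Longrightarrow> \<zero>\<^bsub>R\<^esub> \<odot>\<^bsub>M\<^esub> m = \<zero>\<^bsub>M\<^esub>"

definition faithful :: "('a, 'c) ring_scheme \<Rightarrow> ('a, 'm, 'd) module_scheme \<Rightarrow> bool" where
  "faithful R M \<longleftrightarrow>
    {r \<in> carrier R. \<forall>m\<in>carrier M. r \<odot>\<^bsub>M\<^esub> m = \<zero>\<^bsub>M\<^esub>} = {\<zero>\<^bsub>R\<^esub>}"

definition irreducible_semimodule ::
    "('a, 'c) ring_scheme \<Rightarrow> ('a, 'm, 'd) module_scheme \<Rightarrow> bool" where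
  "irreducible_semimodule R M \<longleftrightarrow>
    left_semimodule R M \<and> carrier M \<noteq> {\<zero>\<^bsub>M\<^esub>} \<and> add_cancellative M \<and>
    (\<forall>m1\<in>carrier M. \<forall>m2\<in>carrier M. \<forall>m\<in>carrier M. m1 \<noteq> m2 \<longrightarrow>
      (\<exists>r1\<in>carrier R. \<exists>r2\<in>carrier R.
        m \<oplus>\<^bsub>M\<^esub> r1 \<odot>\<^bsub>M\<^esub> m1 \<oplus>\<^bsub>M\<^esub> r2 \<odot>\<^bsub>M\<^esub> m2 = r1 \<odot>\<^bsub>M\<^esub> m2 \<oplus>\<^bsub>M\<^esub> r2 \<odot>\<^bsub>M\<^esub> m1))"

text \<open>
  A bound type variable is not available, so the semimodule is sought on the type \<open>'a \<times> 'a\<close>.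
  This loses nothing: an irreducible semimodule embeds, as a set, into \<open>R \<times> R\<close>
  (lemma \<open>primitiveI\<close> below, which allows a semimodule on any type).
\<close>

definition primitive :: "('a, 'c) ring_scheme \<Rightarrow> bool" where
  "primitive R \<longleftrightarrow>
    (\<exists>M :: ('a, 'a \<times> 'a) module. irreducible_semimodule R M \<and> faithful R M)"

text \<open>Homomorphisms do not have to respect \<open>one\<close>, in contrast to \<open>ring_hom\<close>.\<close>

definition hemiring_hom ::
    "('a, 'c) ring_scheme \<Rightarrow> ('b, 'd) ring_scheme \<Rightarrow> ('a \<Rightarrow> 'b) set" where
  "hemiring_hom R S =
    {f \<in> hom R S. (\<forall>x\<in>carrier R. \<forall>y\<in>carrier R. f (x \<oplus>\<^bsub>R\<^esub> y) = f x \<oplus>\<^bsub>S\<^esub> f y) \<and>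
      f \<zero>\<^bsub>R\<^esub> = \<zero>\<^bsub>S\<^esub>}"

definition hemiring_isomorphic :: "('a, 'c) ring_scheme \<Rightarrow> ('b, 'd) ring_scheme \<Rightarrow> bool" where
  "hemiring_isomorphic R S \<longleftrightarrow> (\<exists>f\<in>hemiring_hom R S. bij_betw f (carrier R) (carrier S))"

definition semiisomorphic :: "('a, 'c) ring_scheme \<Rightarrow> ('b, 'd) ring_scheme \<Rightarrow> bool" where
  "semiisomorphic R S \<longleftrightarrow>
    (\<exists>f\<in>hemiring_hom R S. f ` carrier R = carrier S \<and>
      {a \<in> carrier R. f a = \<zero>\<^bsub>S\<^esub>} = {\<zero>\<^bsub>R\<^esub>})"


section \<open>The ring of differences\<close>

definition diff_rel :: "('a, 'c) ring_scheme \<Rightarrow> (('a \<times> 'a) \<times> ('a \<times> 'a)) set" where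
  "diff_rel S =
    {((a, b), (c, d)). a \<in> carrier S \<and> b \<in> carrier S \<and> c \<in> carrier S \<and> d \<in> carrier S \<and>
      (\<exists>w\<in>carrier S. \<exists>w'\<in>carrier S. a \<oplus>\<^bsub>S\<^esub> w = c \<oplus>\<^bsub>S\<^esub> w' \<and> b \<oplus>\<^bsub>S\<^esub> w = d \<oplus>\<^bsub>S\<^esub> w')}"

definition diff_class :: "('a, 'c) ring_scheme \<Rightarrow> 'a \<Rightarrow> 'a \<Rightarrow> ('a \<times> 'a) set" where
  "diff_class S a b = diff_rel S `` {(a, b)}"

text \<open>For independence of representatives see \<open>diff_ring_add\<close> and \<open>diff_ring_mult\<close>.\<close>

definition diff_ring :: "('a, 'c) ring_scheme \<Rightarrow> ('a \<times> 'a) set ring" where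
  "diff_ring S =
    \<lparr>carrier = (carrier S \<times> carrier S) // diff_rel S,
     mult = (\<lambda>X Y. \<Union>(a, b)\<in>X. \<Union>(c, d)\<in>Y.
       diff_class S (a \<otimes>\<^bsub>S\<^esub> c \<oplus>\<^bsub>S\<^esub> b \<otimes>\<^bsub>S\<^esub> d) (a \<otimes>\<^bsub>S\<^esub> d \<oplus>\<^bsub>S\<^esub> b \<otimes>\<^bsub>S\<^esub> c)),
     one = undefined,
     zero = diff_class S \<zero>\<^bsub>S\<^esub> \<zero>\<^bsub>S\<^esub>,
     add = (\<lambda>X Y. \<Union>(a, b)\<in>X. \<Union>(c, d)\<in>Y. diff_class S (a \<oplus>\<^bsub>S\<^esub> c) (b \<oplus>\<^bsub>S\<^esub> d))\<rparr>"


section \<open>Dense rings of linear transformations\<close>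

locale division_ring = ring D for D (structure) +
  assumes division_Units: "Units D = carrier D - {\<zero>}"

text \<open>
  Scalars are written on the side opposite to linear transformations.  Primitivity refers to
  \<^emph>\<open>left\<close> semimodules, so linear transformations act on the left, with the product
  \<open>(s t) v = s (t v)\<close>, and vector spaces are \<^emph>\<open>right\<close> vector spaces.  (With left vector spaces
  and the opposite product one would get the right primitive rings instead, and these differ from
  the left primitive ones by an example of Bergman.)
  The scalar multiplication of the record type takes the scalar first: \<open>d \<odot> v\<close> stands for
  the product \<open>v d\<close> in a right vector space.
\<close>

locale right_vector_space = D?: division_ring D + V?: abelian_group V
  for D (structure) and V (structure) +
  assumes scale_closed: "\<lbrakk>d \<in> carrier D; v \<in> carrier V\<rbrakk> \<Longrightarrow> d \<odot>\<^bsub>V\<^esub> v \<in> carrier V"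
    and scale_assoc: "\<lbrakk>d \<in> carrier D; e \<in> carrier D; v \<in> carrier V\<rbrakk>
      \<Longrightarrow> (d \<otimes>\<^bsub>D\<^esub> e) \<odot>\<^bsub>V\<^esub> v = e \<odot>\<^bsub>V\<^esub> (d \<odot>\<^bsub>V\<^esub> v)"
    and scale_add_vector: "\<lbrakk>d \<in> carrier D; v \<in> carrier V; w \<in> carrier V\<rbrakk>
      \<Longrightarrow> d \<odot>\<^bsub>V\<^esub> (v \<oplus>\<^bsub>V\<^esub> w) = d \<odot>\<^bsub>V\<^esub> v \<oplus>\<^bsub>V\<^esub> d \<odot>\<^bsub>V\<^esub> w"
    and scale_add_scalar: "\<lbrakk>d \<in> carrier D; e \<in> carrier D; v \<in> carrier V\<rbrakk>
      \<Longrightarrow> (d \<oplus>\<^bsub>D\<^esub> e) \<odot>\<^bsub>V\<^esub> v = d \<odot>\<^bsub>V\<^esub> v \<oplus>\<^bsub>V\<^esub> e \<odot>\<^bsub>V\<^esub> v"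
    and scale_one: "v \<in> carrier V \<Longrightarrow> \<one>\<^bsub>D\<^esub> \<odot>\<^bsub>V\<^esub> v = v"

definition End_ring ::
    "('d, 'c) ring_scheme \<Rightarrow> ('d, 'v, 'e) module_scheme \<Rightarrow> ('v \<Rightarrow> 'v) ring" where
  "End_ring D V =
    \<lparr>carrier = {f \<in> carrier V \<rightarrow>\<^sub>E carrier V.
       (\<forall>v\<in>carrier V. \<forall>w\<in>carrier V. f (v \<oplus>\<^bsub>V\<^esub> w) = f v \<oplus>\<^bsub>V\<^esub> f w) \<and>
       (\<forall>d\<in>carrier D. \<forall>v\<in>carrier V. f (d \<odot>\<^bsub>V\<^esub> v) = d \<odot>\<^bsub>V\<^esub> f v)},
     mult = (\<lambda>s t. \<lambda>v\<in>carrier V. s (t v)),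
     one = (\<lambda>v\<in>carrier V. v),
     zero = (\<lambda>v\<in>carrier V. \<zero>\<^bsub>V\<^esub>),
     add = (\<lambda>s t. \<lambda>v\<in>carrier V. s v \<oplus>\<^bsub>V\<^esub> t v)\<rparr>"

definition lin_independent ::
    "('d, 'c) ring_scheme \<Rightarrow> ('d, 'v, 'e) module_scheme \<Rightarrow> nat \<Rightarrow> (nat \<Rightarrow> 'v) \<Rightarrow> bool" where
  "lin_independent D V n v \<longleftrightarrow>
    v \<in> {..<n} \<rightarrow> carrier V \<and>
    (\<forall>c\<in>{..<n} \<rightarrow> carrier D.
      (\<Oplus>\<^bsub>V\<^esub>i\<in>{..<n}. c i \<odot>\<^bsub>V\<^esub> v i) = \<zero>\<^bsub>V\<^esub> \<longrightarrow> (\<forall>i<n. c i = \<zero>\<^bsub>D\<^esub>))"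

text \<open>Subrings are not required to contain the identity of \<open>End_ring D V\<close>.\<close>

definition dense_subring ::
    "('d, 'c) ring_scheme \<Rightarrow> ('d, 'v, 'e) module_scheme \<Rightarrow> ('v \<Rightarrow> 'v) set \<Rightarrow> bool" where
  "dense_subring D V T \<longleftrightarrow>
    subgroup T (add_monoid (End_ring D V)) \<and>
    (\<forall>s\<in>T. \<forall>t\<in>T. s \<otimes>\<^bsub>End_ring D V\<^esub> t \<in> T) \<and>
    (\<forall>n v w. lin_independent D V n v \<and> w \<in> {..<n} \<rightarrow> carrier V \<longrightarrow>
      (\<exists>t\<in>T. \<forall>i<n. t (v i) = w i))"

text \<open>
  The vector space has to be nonzero: the zero ring is dense in the endomorphism ring of the zero
  space, but it has no faithful irreducible module.
  Both \<open>D\<close> and \<open>V\<close> are sought on the type of \<open>A\<close>; again this loses nothing, since \<open>V = T v\<close>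
  and \<open>D\<close> embeds into \<open>V\<close> (lemma \<open>isomorphic_to_dense_subringI\<close> below).
\<close>

definition isomorphic_to_dense_subring :: "('a, 'c) ring_scheme \<Rightarrow> bool" where
  "isomorphic_to_dense_subring A \<longleftrightarrow>
    (\<exists>(D :: 'a ring) (V :: ('a, 'a) module) T.
      right_vector_space D V \<and> carrier V \<noteq> {\<zero>\<^bsub>V\<^esub>} \<and> dense_subring D V T \<and>
      hemiring_isomorphic A (End_ring D V \<lparr>carrier := T\<rparr>))"


section \<open>Well-definedness of the constructions\<close>

lemma diff_relE:
  assumes "(x, y) \<in> diff_rel R"
  obtains a b c d w w' where "x = (a, b)" "y = (c, d)"
    "a \<in> carrier R" "b \<in> carrier R" "c \<in> carrier R" "d \<in> carrier R"
    "w \<in> carrier R" "w' \<in> carrier R" "a \<oplus>\<^bsub>R\<^esub> w = c \<oplus>\<^bsub>R\<^esub> w'" "b \<oplus>\<^bsub>R\<^esub> w = d \<oplus>\<^bsub>R\<^esub> w'"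
  using assms unfolding diff_rel_def by blast

lemma (in abelian_monoid) diff_rel_equiv: "equiv (carrier G \<times> carrier G) (diff_rel G)"
proof (rule equivI)
  show "diff_rel G \<subseteq> (carrier G \<times> carrier G) \<times> (carrier G \<times> carrier G)"
    by (auto simp: diff_rel_def)
  show "refl_on (carrier G \<times> carrier G) (diff_rel G)"
    by (auto simp: diff_rel_def refl_on_def)
  show "sym (diff_rel G)"
    by (rule symI, elim diff_relE) (unfold diff_rel_def, force)
  show "trans (diff_rel G)"
  proof (rule transI)
    fix x y z assume "(x, y) \<in> diff_rel G" "(y, z) \<in> diff_rel G"
    then obtain a b c d e f w w' u u' where *: "x = (a, b)" "y = (c, d)" "z = (e, f)"
      and c: "a \<in> carrier G" "b \<in> carrier G" "c \<in> carrier G" "d \<in> carrier G"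
        "e \<in> carrier G" "f \<in> carrier G" "w \<in> carrier G" "w' \<in> carrier G"
        "u \<in> carrier G" "u' \<in> carrier G"
      and eq: "a \<oplus> w = c \<oplus> w'" "b \<oplus> w = d \<oplus> w'" "c \<oplus> u = e \<oplus> u'" "d \<oplus> u = f \<oplus> u'"
      unfolding diff_rel_def by auto
    have gen: "p \<oplus> (w \<oplus> u) = r \<oplus> (w' \<oplus> u')"
      if "p \<in> carrier G" "q \<in> carrier G" "r \<in> carrier G"
        "p \<oplus> w = q \<oplus> w'" "q \<oplus> u = r \<oplus> u'" for p q r
    proof -
      have "p \<oplus> (w \<oplus> u) = (p \<oplus> w) \<oplus> u" using that(1-3) c by (simp add: a_assoc)
      also have "\<dots> = (q \<oplus> w') \<oplus> u" using that by simp
      also have "\<dots> = (q \<oplus> u) \<oplus> w'" using that(1-3) c by (simp add: a_ac)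
      also have "\<dots> = (r \<oplus> u') \<oplus> w'" using that by simp
      also have "\<dots> = r \<oplus> (w' \<oplus> u')" using that(1-3) c by (simp add: a_ac)
      finally show ?thesis .
    qed
    have "a \<oplus> (w \<oplus> u) = e \<oplus> (w' \<oplus> u')" "b \<oplus> (w \<oplus> u) = f \<oplus> (w' \<oplus> u')"
      using gen[of a c e] gen[of b d f] c eq by auto
    moreover have "w \<oplus> u \<in> carrier G" "w' \<oplus> u' \<in> carrier G" using c by auto
    ultimately show "(x, z) \<in> diff_rel G"
      using c * unfolding diff_rel_def by blast
  qed
qed

lemma (in hemiring) diff_relI:
  assumes "a \<in> carrier R" "b \<in> carrier R" "c \<in> carrier R" "d \<in> carrier R"
    "w \<in> carrier R" "w' \<in> carrier R" "a \<oplus> w = c \<oplus> w'" "b \<oplus> w = d \<oplus> w'"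
  shows "((a, b), (c, d)) \<in> diff_rel R"
  using assms unfolding diff_rel_def by blast

lemma (in hemiring) diff_class_carrier:
  assumes "a \<in> carrier R" "b \<in> carrier R"
  shows "diff_class R a b \<in> carrier (diff_ring R)"
  using assms by (auto simp: diff_class_def diff_ring_def quotient_def)

lemma (in hemiring) diff_class_eq_iff:
  assumes "a \<in> carrier R" "b \<in> carrier R" "c \<in> carrier R" "d \<in> carrier R"
  shows "diff_class R a b = diff_class R c d \<longleftrightarrow> ((a, b), (c, d)) \<in> diff_rel R"
  unfolding diff_class_def by (rule eq_equiv_class_iff[OF diff_rel_equiv]) (use assms in auto)

lemma (in hemiring) diff_class_eq_iff_cancel:
  assumes "add_cancellative R"
    and c: "a \<in> carrier R" "b \<in> carrier R" "c \<in> carrier R" "d \<in> carrier R"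
  shows "diff_class R a b = diff_class R c d \<longleftrightarrow> a \<oplus> d = c \<oplus> b"
proof
  assume "diff_class R a b = diff_class R c d"
  then obtain w w' where w: "w \<in> carrier R" "w' \<in> carrier R" "a \<oplus> w = c \<oplus> w'" "b \<oplus> w = d \<oplus> w'"
    using c unfolding diff_class_eq_iff[OF c] diff_rel_def by auto
  have "(a \<oplus> d) \<oplus> (w \<oplus> w') = (a \<oplus> w) \<oplus> (d \<oplus> w')" using c w(1,2) by (simp add: a_ac)
  also have "\<dots> = (c \<oplus> w') \<oplus> (b \<oplus> w)" using w by simp
  also have "\<dots> = (c \<oplus> b) \<oplus> (w \<oplus> w')" using c w(1,2) by (simp add: a_ac)
  finally show "a \<oplus> d = c \<oplus> b"
    using assms(1) c w(1,2) unfolding add_cancellative_def by (meson add.m_closed)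
next
  assume "a \<oplus> d = c \<oplus> b"
  with c show "diff_class R a b = diff_class R c d"
    unfolding diff_class_eq_iff[OF c] by (intro diff_relI[of _ _ _ _ d b]) (auto simp: a_ac)
qed

lemma UN_quotient_pair:
  assumes equiv: "equiv A r" and "X \<in> A // r" "Y \<in> A // r"
    and "\<And>x x' y y'. (x, x') \<in> r \<Longrightarrow> (y, y') \<in> r \<Longrightarrow> F x y = F x' y'"
    and "x \<in> X" "y \<in> Y"
  shows "(\<Union>x\<in>X. \<Union>y\<in>Y. F x y) = F x y"
proof -
  have "F x' y' = F x y" if "x' \<in> X" "y' \<in> Y" for x' y'
    using assms that by (meson quotient_eq_iff)
  then show ?thesis using assms(5,6) by blast
qed

lemma (in hemiring) diff_ring_add:
  assumes c: "a \<in> carrier R" "b \<in> carrier R" "c \<in> carrier R" "d \<in> carrier R"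
  shows "diff_class R a b \<oplus>\<^bsub>diff_ring R\<^esub> diff_class R c d = diff_class R (a \<oplus> c) (b \<oplus> d)"
proof -
  let ?F = "\<lambda>(a, b) (c, d). diff_class R (a \<oplus> c) (b \<oplus> d)"
  have cong: "?F x y = ?F x' y'" if xx: "(x, x') \<in> diff_rel R" and yy: "(y, y') \<in> diff_rel R" for x x' y y'
  proof -
    obtain a b a' b' w w' where x: "x = (a, b)" "x' = (a', b')"
      and cx: "a \<in> carrier R" "b \<in> carrier R" "a' \<in> carrier R" "b' \<in> carrier R"
        "w \<in> carrier R" "w' \<in> carrier R"
      and ex: "a \<oplus> w = a' \<oplus> w'" "b \<oplus> w = b' \<oplus> w'"
      by (rule diff_relE[OF xx])
    obtain c d c' d' u u' where y: "y = (c, d)" "y' = (c', d')"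
      and cy: "c \<in> carrier R" "d \<in> carrier R" "c' \<in> carrier R" "d' \<in> carrier R"
        "u \<in> carrier R" "u' \<in> carrier R"
      and ey: "c \<oplus> u = c' \<oplus> u'" "d \<oplus> u = d' \<oplus> u'"
      by (rule diff_relE[OF yy])
    have gen: "(p \<oplus> q) \<oplus> (w \<oplus> u) = (p' \<oplus> q') \<oplus> (w' \<oplus> u')"
      if "p \<in> carrier R" "q \<in> carrier R" "p' \<in> carrier R" "q' \<in> carrier R"
        "p \<oplus> w = p' \<oplus> w'" "q \<oplus> u = q' \<oplus> u'" for p q p' q'
    proof -
      have "(p \<oplus> q) \<oplus> (w \<oplus> u) = (p \<oplus> w) \<oplus> (q \<oplus> u)"
        using that(1-4) cx cy by (simp add: a_ac)
      also have "\<dots> = (p' \<oplus> q') \<oplus> (w' \<oplus> u')"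
        unfolding that(5,6) using that(1-4) cx cy by (simp add: a_ac)
      finally show ?thesis .
    qed
    show ?thesis unfolding x y prod.case
      apply (subst diff_class_eq_iff)
      using cx cy apply auto[4]
      apply (rule diff_relI[of _ _ _ _ "w \<oplus> u" "w' \<oplus> u'"])
      using gen[of a c a' c'] gen[of b d b' d'] cx cy ex ey by auto
  qed
  have mem: "(a, b) \<in> diff_class R a b" "(c, d) \<in> diff_class R c d"
    using c equiv_class_self[OF diff_rel_equiv] unfolding diff_class_def by auto
  have "diff_class R a b \<in> (carrier R \<times> carrier R) // diff_rel R"
    "diff_class R c d \<in> (carrier R \<times> carrier R) // diff_rel R"
    using c diff_class_carrier unfolding diff_ring_def by auto
  from UN_quotient_pair[where F = ?F, OF diff_rel_equiv this cong mem] show ?thesis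
    unfolding diff_ring_def by (simp add: case_prod_unfold)
qed

lemma (in hemiring) diff_ring_mult:
  assumes c: "a \<in> carrier R" "b \<in> carrier R" "c \<in> carrier R" "d \<in> carrier R"
  shows "diff_class R a b \<otimes>\<^bsub>diff_ring R\<^esub> diff_class R c d =
    diff_class R (a \<otimes> c \<oplus> b \<otimes> d) (a \<otimes> d \<oplus> b \<otimes> c)"
proof -
  let ?F = "\<lambda>(a, b) (c, d). diff_class R (a \<otimes> c \<oplus> b \<otimes> d) (a \<otimes> d \<oplus> b \<otimes> c)"
  note [simp] = m_closed
  have cong1: "?F x y = ?F x' y"
    if xx: "(x, x') \<in> diff_rel R" and yR: "y \<in> carrier R \<times> carrier R" for x x' y
  proof -
    obtain a b a' b' w w' where x: "x = (a, b)" "x' = (a', b')"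
      and cx: "a \<in> carrier R" "b \<in> carrier R" "a' \<in> carrier R" "b' \<in> carrier R"
        "w \<in> carrier R" "w' \<in> carrier R"
      and ex: "a \<oplus> w = a' \<oplus> w'" "b \<oplus> w = b' \<oplus> w'"
      by (rule diff_relE[OF xx])
    obtain c d where y: "y = (c, d)" and cy: "c \<in> carrier R" "d \<in> carrier R"
      using yR by auto
    have gen: "(a \<otimes> p \<oplus> b \<otimes> q) \<oplus> (w \<otimes> p \<oplus> w \<otimes> q) = (a' \<otimes> p \<oplus> b' \<otimes> q) \<oplus> (w' \<otimes> p \<oplus> w' \<otimes> q)"
      if "p \<in> carrier R" "q \<in> carrier R" for p q
    proof -
      have "(a \<otimes> p \<oplus> b \<otimes> q) \<oplus> (w \<otimes> p \<oplus> w \<otimes> q) = (a \<oplus> w) \<otimes> p \<oplus> (b \<oplus> w) \<otimes> q"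
        using that cx by (simp add: a_ac l_distr)
      also have "\<dots> = (a' \<otimes> p \<oplus> b' \<otimes> q) \<oplus> (w' \<otimes> p \<oplus> w' \<otimes> q)"
        unfolding ex using that cx by (simp add: a_ac l_distr)
      finally show ?thesis .
    qed
    show ?thesis unfolding x y prod.case
      apply (subst diff_class_eq_iff)
      using cx cy apply auto[4]
      apply (rule diff_relI[of _ _ _ _ "w \<otimes> c \<oplus> w \<otimes> d" "w' \<otimes> c \<oplus> w' \<otimes> d"])
      using gen[of c d] gen[of d c] cx cy by (auto simp: a_comm)
  qed
  have cong2: "?F x y = ?F x y'"
    if xR: "x \<in> carrier R \<times> carrier R" and yy: "(y, y') \<in> diff_rel R" for x y y'
  proof -
    obtain c d c' d' w w' where y: "y = (c, d)" "y' = (c', d')"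
      and cy: "c \<in> carrier R" "d \<in> carrier R" "c' \<in> carrier R" "d' \<in> carrier R"
        "w \<in> carrier R" "w' \<in> carrier R"
      and ey: "c \<oplus> w = c' \<oplus> w'" "d \<oplus> w = d' \<oplus> w'"
      by (rule diff_relE[OF yy])
    obtain a b where x: "x = (a, b)" and cx: "a \<in> carrier R" "b \<in> carrier R"
      using xR by auto
    have gen: "(p \<otimes> c \<oplus> q \<otimes> d) \<oplus> (p \<otimes> w \<oplus> q \<otimes> w) = (p \<otimes> c' \<oplus> q \<otimes> d') \<oplus> (p \<otimes> w' \<oplus> q \<otimes> w')"
      if "p \<in> carrier R" "q \<in> carrier R" for p q
    proof -
      have "(p \<otimes> c \<oplus> q \<otimes> d) \<oplus> (p \<otimes> w \<oplus> q \<otimes> w) = p \<otimes> (c \<oplus> w) \<oplus> q \<otimes> (d \<oplus> w)"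
        using that cy by (simp add: a_ac r_distr)
      also have "\<dots> = (p \<otimes> c' \<oplus> q \<otimes> d') \<oplus> (p \<otimes> w' \<oplus> q \<otimes> w')"
        unfolding ey using that cy by (simp add: a_ac r_distr)
      finally show ?thesis .
    qed
    show ?thesis unfolding x y prod.case
      apply (subst diff_class_eq_iff)
      using cx cy apply auto[4]
      apply (rule diff_relI[of _ _ _ _ "a \<otimes> w \<oplus> b \<otimes> w" "a \<otimes> w' \<oplus> b \<otimes> w'"])
      using gen[of a b] gen[of b a] cx cy by (auto simp: a_comm)
  qed
  have cong: "?F x y = ?F x' y'" if xx: "(x, x') \<in> diff_rel R" and yy: "(y, y') \<in> diff_rel R" for x x' y y'
  proof -
    have "y \<in> carrier R \<times> carrier R" "x' \<in> carrier R \<times> carrier R"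
      using xx yy unfolding diff_rel_def by auto
    from trans[OF cong1[OF xx this(1)] cong2[OF this(2) yy]] show ?thesis .
  qed
  have mem: "(a, b) \<in> diff_class R a b" "(c, d) \<in> diff_class R c d"
    using c equiv_class_self[OF diff_rel_equiv] unfolding diff_class_def by auto
  have "diff_class R a b \<in> (carrier R \<times> carrier R) // diff_rel R"
    "diff_class R c d \<in> (carrier R \<times> carrier R) // diff_rel R"
    using c diff_class_carrier unfolding diff_ring_def by auto
  from UN_quotient_pair[where F = ?F, OF diff_rel_equiv this cong mem] show ?thesis
    unfolding diff_ring_def by (simp add: case_prod_unfold)
qed

lemma (in hemiring) diff_ring_cases:
  assumes "X \<in> carrier (diff_ring R)"
  obtains a b where "a \<in> carrier R" "b \<in> carrier R" "X = diff_class R a b"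
  using assms unfolding diff_ring_def diff_class_def by (auto elim!: quotientE)

lemma (in hemiring) diff_ring_zero: "\<zero>\<^bsub>diff_ring R\<^esub> = diff_class R \<zero> \<zero>"
  by (simp add: diff_ring_def)

lemma (in hemiring) diff_ring_hemiring: "hemiring (diff_ring R)"
proof -
  note [simp] = m_closed l_distr r_distr m_assoc l_null r_null
    diff_ring_add diff_ring_mult diff_ring_zero diff_class_carrier
  show ?thesis
    by (intro hemiring.intro abelian_monoidI hemiring_axioms.intro)
      (auto elim!: diff_ring_cases simp: a_ac)
qed

lemma (in hemiring) diff_ring_abelian_group: "abelian_group (diff_ring R)"
proof -
  interpret D: hemiring "diff_ring R" by (rule diff_ring_hemiring)
  show ?thesis
  proof (rule abelian_groupI)
    fix x assume "x \<in> carrier (diff_ring R)"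
    then obtain a b where x: "a \<in> carrier R" "b \<in> carrier R" "x = diff_class R a b"
      by (rule diff_ring_cases)
    then have "diff_class R b a \<oplus>\<^bsub>diff_ring R\<^esub> x = \<zero>\<^bsub>diff_ring R\<^esub>"
      apply (simp add: diff_ring_add diff_ring_zero)
      apply (subst diff_class_eq_iff)
      apply auto[4]
      apply (rule diff_relI[of _ _ _ _ "\<zero>" "a \<oplus> b"])
      by (auto simp: a_ac)
    then show "\<exists>y\<in>carrier (diff_ring R). y \<oplus>\<^bsub>diff_ring R\<^esub> x = \<zero>\<^bsub>diff_ring R\<^esub>"
      using x diff_class_carrier by blast
  qed (simp_all add: D.a_ac)
qed

lemma (in right_vector_space) scale_zero: "d \<in> carrier D \<Longrightarrow> d \<odot>\<^bsub>V\<^esub> \<zero>\<^bsub>V\<^esub> = \<zero>\<^bsub>V\<^esub>"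
  by (metis V.add.r_cancel_one' V.l_zero V.zero_closed scale_add_vector scale_closed)

lemma (in right_vector_space) scale_null: "v \<in> carrier V \<Longrightarrow> \<zero>\<^bsub>D\<^esub> \<odot>\<^bsub>V\<^esub> v = \<zero>\<^bsub>V\<^esub>"
  by (metis V.add.r_cancel_one' D.l_zero D.zero_closed scale_add_scalar scale_closed)

lemma (in right_vector_space) scale_eq_zero:
  assumes "d \<in> carrier D" "v \<in> carrier V" "d \<odot>\<^bsub>V\<^esub> v = \<zero>\<^bsub>V\<^esub>" "v \<noteq> \<zero>\<^bsub>V\<^esub>"
  shows "d = \<zero>\<^bsub>D\<^esub>"
proof (rule ccontr)
  assume "d \<noteq> \<zero>\<^bsub>D\<^esub>"
  then have u: "d \<in> Units D" using assms division_Units by auto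
  then have "v = inv\<^bsub>D\<^esub> d \<odot>\<^bsub>V\<^esub> (d \<odot>\<^bsub>V\<^esub> v)"
    using assms scale_assoc[of d "inv\<^bsub>D\<^esub> d" v] scale_one by simp
  then show False using assms u scale_zero by simp
qed

lemma (in right_vector_space) ring_End_ring: "ring (End_ring D V)"
proof (intro ringI abelian_groupI)
  fix f assume f: "f \<in> carrier (End_ring D V)"
  have "(\<lambda>v\<in>carrier V. \<ominus>\<^bsub>V\<^esub> f v) \<in> carrier (End_ring D V)"
  proof -
    have "d \<odot>\<^bsub>V\<^esub> (\<ominus>\<^bsub>V\<^esub> v) = \<ominus>\<^bsub>V\<^esub> (d \<odot>\<^bsub>V\<^esub> v)" if "d \<in> carrier D" "v \<in> carrier V" for d v
      using scale_add_vector[of d "\<ominus>\<^bsub>V\<^esub> v" v] that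
      by (simp add: scale_zero scale_closed V.minus_equality V.l_neg)
    then show ?thesis
      using f by (auto simp: End_ring_def scale_closed V.minus_add PiE_iff)
  qed
  moreover have "(\<lambda>v\<in>carrier V. \<ominus>\<^bsub>V\<^esub> f v) \<oplus>\<^bsub>End_ring D V\<^esub> f = \<zero>\<^bsub>End_ring D V\<^esub>"
    using f by (auto simp: End_ring_def V.l_neg PiE_iff fun_eq_iff)
  ultimately show "\<exists>g\<in>carrier (End_ring D V). g \<oplus>\<^bsub>End_ring D V\<^esub> f = \<zero>\<^bsub>End_ring D V\<^esub>" by blast
next
  show "monoid (End_ring D V)"
    by unfold_locales (auto simp: End_ring_def PiE_iff scale_closed V.a_closed extensional_def fun_eq_iff)
qed (auto simp: End_ring_def scale_add_vector scale_zero scale_closed V.a_ac PiE_iff extensional_def fun_eq_iff)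


section \<open>Independence of the types used for the witnesses\<close>

definition transport_ring :: "('a \<Rightarrow> 'b) \<Rightarrow> ('a, 'c) ring_scheme \<Rightarrow> 'b ring" where
  "transport_ring h R =
    \<lparr>carrier = h ` carrier R,
     mult = (\<lambda>x y. h (inv_into (carrier R) h x \<otimes>\<^bsub>R\<^esub> inv_into (carrier R) h y)),
     one = h \<one>\<^bsub>R\<^esub>,
     zero = h \<zero>\<^bsub>R\<^esub>,
     add = (\<lambda>x y. h (inv_into (carrier R) h x \<oplus>\<^bsub>R\<^esub> inv_into (carrier R) h y))\<rparr>"

definition transport_module ::
    "('a, 'c) ring_scheme \<Rightarrow> ('a \<Rightarrow> 'b) \<Rightarrow> ('m \<Rightarrow> 'n) \<Rightarrow> ('a, 'm, 'd) module_scheme \<Rightarrow> ('b, 'n) module"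
  where
  "transport_module R h g M =
    \<lparr>carrier = g ` carrier M,
     mult = undefined,
     one = undefined,
     zero = g \<zero>\<^bsub>M\<^esub>,
     add = (\<lambda>x y. g (inv_into (carrier M) g x \<oplus>\<^bsub>M\<^esub> inv_into (carrier M) g y)),
     smult = (\<lambda>r x. g (inv_into (carrier R) h r \<odot>\<^bsub>M\<^esub> inv_into (carrier M) g x))\<rparr>"

lemma transport_ring_simps:
  "carrier (transport_ring h R) = h ` carrier R"
  "\<zero>\<^bsub>transport_ring h R\<^esub> = h \<zero>\<^bsub>R\<^esub>"
  "\<one>\<^bsub>transport_ring h R\<^esub> = h \<one>\<^bsub>R\<^esub>"
  "\<lbrakk>inj_on h (carrier R); x \<in> carrier R; y \<in> carrier R\<rbrakk>
    \<Longrightarrow> h x \<oplus>\<^bsub>transport_ring h R\<^esub> h y = h (x \<oplus>\<^bsub>R\<^esub> y)"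
  "\<lbrakk>inj_on h (carrier R); x \<in> carrier R; y \<in> carrier R\<rbrakk>
    \<Longrightarrow> h x \<otimes>\<^bsub>transport_ring h R\<^esub> h y = h (x \<otimes>\<^bsub>R\<^esub> y)"
  by (auto simp: transport_ring_def)

lemma transport_module_simps:
  "carrier (transport_module R h g M) = g ` carrier M"
  "\<zero>\<^bsub>transport_module R h g M\<^esub> = g \<zero>\<^bsub>M\<^esub>"
  "\<lbrakk>inj_on g (carrier M); x \<in> carrier M; y \<in> carrier M\<rbrakk>
    \<Longrightarrow> g x \<oplus>\<^bsub>transport_module R h g M\<^esub> g y = g (x \<oplus>\<^bsub>M\<^esub> y)"
  "\<lbrakk>inj_on h (carrier R); inj_on g (carrier M); r \<in> carrier R; x \<in> carrier M\<rbrakk>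
    \<Longrightarrow> h r \<odot>\<^bsub>transport_module R h g M\<^esub> g x = g (r \<odot>\<^bsub>M\<^esub> x)"
  by (auto simp: transport_module_def)

lemma hemiring_transport:
  assumes "hemiring R" "inj_on h (carrier R)"
  shows "hemiring (transport_ring h R)"
proof -
  interpret hemiring R by fact
  note [simp] = transport_ring_simps m_closed l_distr r_distr m_assoc l_null r_null
  show ?thesis using assms(2)
    by (intro hemiring.intro abelian_monoidI hemiring_axioms.intro) (auto simp: a_ac)
qed

lemma ring_transport:
  assumes "ring R" "inj_on h (carrier R)"
  shows "ring (transport_ring h R)"
proof -
  interpret ring R by fact
  note [simp] = transport_ring_simps l_distr r_distr m_assoc
  have "monoid (transport_ring h R)"
    using assms(2) by unfold_locales auto
  moreover have "abelian_group (transport_ring h R)"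
  proof (rule abelian_groupI)
    fix x assume "x \<in> carrier (transport_ring h R)"
    then obtain a where "a \<in> carrier R" "x = h a" by auto
    then show "\<exists>y\<in>carrier (transport_ring h R). y \<oplus>\<^bsub>transport_ring h R\<^esub> x = \<zero>\<^bsub>transport_ring h R\<^esub>"
      using assms(2) by (intro bexI[of _ "h (\<ominus>\<^bsub>R\<^esub> a)"]) (auto simp: l_neg)
  qed (use assms(2) in \<open>auto simp: a_ac\<close>)
  ultimately show ?thesis
    using assms(2) by (intro ringI) auto
qed

lemma division_ring_transport:
  assumes "division_ring D" "inj_on h (carrier D)"
  shows "division_ring (transport_ring h D)"
proof -
  interpret division_ring D by fact
  have "Units (transport_ring h D) = h ` Units D"
    using assms(2) unfolding Units_def
    by (auto simp: transport_ring_simps inj_on_eq_iff[OF assms(2)] intro!: imageI)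
  also have "\<dots> = carrier (transport_ring h D) - {\<zero>\<^bsub>transport_ring h D\<^esub>}"
    using assms(2) by (auto simp: division_Units transport_ring_simps inj_on_eq_iff[OF assms(2)])
  finally show ?thesis
    using ring_transport[OF _ assms(2)] ring_axioms
    by (simp add: division_ring_def division_ring_axioms_def)
qed

lemma primitiveI:
  fixes R :: "('a, 'c) ring_scheme" and M :: "('a, 'm, 'd) module_scheme"
  assumes irr: "irreducible_semimodule R M" and faith: "faithful R M"
  shows "primitive R"
proof -
  interpret left_semimodule R M using irr by (simp add: irreducible_semimodule_def)
  note [simp] = m_closed smult_closed smult_assoc smult_r_distr smult_l_distr smult_r_null smult_l_null
  have cancel: "x = y" if "x \<oplus>\<^bsub>M\<^esub> z = y \<oplus>\<^bsub>M\<^esub> z" "x \<in> carrier M" "y \<in> carrier M" "z \<in> carrier M" for x y z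
    using irr that unfolding irreducible_semimodule_def add_cancellative_def by blast
  obtain x where x: "x \<in> carrier M" "x \<noteq> \<zero>\<^bsub>M\<^esub>"
    using irr M.zero_closed unfolding irreducible_semimodule_def by blast
  have "\<exists>p. fst p \<in> carrier R \<and> snd p \<in> carrier R \<and>
      m \<oplus>\<^bsub>M\<^esub> fst p \<odot>\<^bsub>M\<^esub> x = snd p \<odot>\<^bsub>M\<^esub> x" if m: "m \<in> carrier M" for m
  proof -
    obtain r1 r2 where r: "r1 \<in> carrier R" "r2 \<in> carrier R"
      "m \<oplus>\<^bsub>M\<^esub> r1 \<odot>\<^bsub>M\<^esub> x \<oplus>\<^bsub>M\<^esub> r2 \<odot>\<^bsub>M\<^esub> \<zero>\<^bsub>M\<^esub> = r1 \<odot>\<^bsub>M\<^esub> \<zero>\<^bsub>M\<^esub> \<oplus>\<^bsub>M\<^esub> r2 \<odot>\<^bsub>M\<^esub> x"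
      using irr x m M.zero_closed unfolding irreducible_semimodule_def by blast
    then show ?thesis using x m by (intro exI[of _ "(r1, r2)"]) auto
  qed
  then obtain g where g: "\<And>m. m \<in> carrier M \<Longrightarrow> fst (g m) \<in> carrier R \<and> snd (g m) \<in> carrier R \<and>
      m \<oplus>\<^bsub>M\<^esub> fst (g m) \<odot>\<^bsub>M\<^esub> x = snd (g m) \<odot>\<^bsub>M\<^esub> x"
    by metis
  have inj: "inj_on g (carrier M)"
  proof (rule inj_onI)
    fix m m' assume "m \<in> carrier M" "m' \<in> carrier M" "g m = g m'"
    with g[of m] g[of m'] x show "m = m'"
      by (intro cancel[of m "fst (g m) \<odot>\<^bsub>M\<^esub> x" m']) auto
  qed
  define N where "N = transport_module R (\<lambda>r. r) g M"
  have id: "inj_on (\<lambda>r. r) (carrier R)" by simp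
  note [simp] = transport_module_simps(3)[of g M _ _ R "\<lambda>r. r", folded N_def, OF inj]
    transport_module_simps(1,2)[of R "\<lambda>r. r" g M, folded N_def]
    transport_module_simps(4)[of "\<lambda>r. r" R g M, folded N_def, OF id inj]
    inj_on_eq_iff[OF inj]
  have "left_semimodule R N"
    by (intro left_semimodule.intro hemiring_axioms abelian_monoidI left_semimodule_axioms.intro)
      (auto simp: M.a_ac)
  moreover have "carrier N \<noteq> {\<zero>\<^bsub>N\<^esub>}"
    using x by (auto dest!: equalityD1)
  moreover have "add_cancellative N"
    unfolding add_cancellative_def by (auto intro: cancel)
  moreover have "\<exists>r1\<in>carrier R. \<exists>r2\<in>carrier R.
      n \<oplus>\<^bsub>N\<^esub> r1 \<odot>\<^bsub>N\<^esub> n1 \<oplus>\<^bsub>N\<^esub> r2 \<odot>\<^bsub>N\<^esub> n2 = r1 \<odot>\<^bsub>N\<^esub> n2 \<oplus>\<^bsub>N\<^esub> r2 \<odot>\<^bsub>N\<^esub> n1"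
    if n: "n1 \<in> carrier N" "n2 \<in> carrier N" "n \<in> carrier N" "n1 \<noteq> n2" for n1 n2 n
  proof -
    obtain m1 m2 m where m: "n1 = g m1" "n2 = g m2" "n = g m"
      "m1 \<in> carrier M" "m2 \<in> carrier M" "m \<in> carrier M" "m1 \<noteq> m2"
      using n by auto
    obtain r1 r2 where "r1 \<in> carrier R" "r2 \<in> carrier R"
      "m \<oplus>\<^bsub>M\<^esub> r1 \<odot>\<^bsub>M\<^esub> m1 \<oplus>\<^bsub>M\<^esub> r2 \<odot>\<^bsub>M\<^esub> m2 = r1 \<odot>\<^bsub>M\<^esub> m2 \<oplus>\<^bsub>M\<^esub> r2 \<odot>\<^bsub>M\<^esub> m1"
      using irr m unfolding irreducible_semimodule_def by blast
    with m show ?thesis by (intro bexI[of _ r1] bexI[of _ r2]) auto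
  qed
  moreover have "faithful R N"
  proof -
    have "{r \<in> carrier R. \<forall>n\<in>carrier N. r \<odot>\<^bsub>N\<^esub> n = \<zero>\<^bsub>N\<^esub>} =
        {r \<in> carrier R. \<forall>m\<in>carrier M. r \<odot>\<^bsub>M\<^esub> m = \<zero>\<^bsub>M\<^esub>}"
      by auto
    then show ?thesis using faith unfolding faithful_def by simp
  qed
  ultimately show ?thesis
    unfolding primitive_def irreducible_semimodule_def by blast
qed

lemma right_vector_space_transport:
  assumes vs: "right_vector_space D V" and h: "inj_on h (carrier D)" and g: "inj_on g (carrier V)"
  shows "right_vector_space (transport_ring h D) (transport_module D h g V)"
proof -
  interpret right_vector_space D V by fact
  note [simp] = transport_ring_simps transport_module_simps h g
    scale_closed scale_add_vector scale_add_scalar scale_one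
  have "abelian_group (transport_module D h g V)"
  proof (rule abelian_groupI)
    fix x assume "x \<in> carrier (transport_module D h g V)"
    then obtain a where "a \<in> carrier V" "x = g a" by auto
    then show "\<exists>y\<in>carrier (transport_module D h g V).
        y \<oplus>\<^bsub>transport_module D h g V\<^esub> x = \<zero>\<^bsub>transport_module D h g V\<^esub>"
      by (intro bexI[of _ "g (\<ominus>\<^bsub>V\<^esub> a)"]) (auto simp: V.l_neg)
  qed (auto simp: V.a_ac)
  moreover have "division_ring (transport_ring h D)"
    using h by (rule division_ring_transport[OF division_ring_axioms])
  ultimately show ?thesis
    by (intro right_vector_space.intro right_vector_space_axioms.intro) (auto simp: scale_assoc)
qed

lemma (in right_vector_space) lin_independent_single:
  assumes "v \<in> carrier V" "v \<noteq> \<zero>\<^bsub>V\<^esub>"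
  shows "lin_independent D V 1 (\<lambda>_. v)"
proof -
  have "c 0 = \<zero>\<^bsub>D\<^esub>" if "c \<in> {..<1} \<rightarrow> carrier D" "(\<Oplus>\<^bsub>V\<^esub>i\<in>{..<1::nat}. c i \<odot>\<^bsub>V\<^esub> v) = \<zero>\<^bsub>V\<^esub>"
    for c :: "nat \<Rightarrow> _"
  proof -
    have "c 0 \<in> carrier D" using that by auto
    moreover have "c 0 \<odot>\<^bsub>V\<^esub> v = \<zero>\<^bsub>V\<^esub>"
      using that assms scale_closed by (simp add: lessThan_Suc)
    ultimately show ?thesis using assms scale_eq_zero by blast
  qed
  then show ?thesis using assms by (auto simp: lin_independent_def)
qed

lemma isomorphic_to_dense_subringI:
  fixes A :: "('e, 'c) ring_scheme" and D :: "('d, 'x) ring_scheme"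
    and V :: "('d, 'v, 'y) module_scheme"
  assumes vs: "right_vector_space D V" and nz: "carrier V \<noteq> {\<zero>\<^bsub>V\<^esub>}"
    and dense: "dense_subring D V T"
    and iso: "hemiring_isomorphic A (End_ring D V \<lparr>carrier := T\<rparr>)"
  shows "isomorphic_to_dense_subring A"
proof -
  interpret right_vector_space D V by fact
  interpret E: ring "End_ring D V" by (rule ring_End_ring)
  obtain \<phi> where hom: "\<phi> \<in> hemiring_hom A (End_ring D V \<lparr>carrier := T\<rparr>)"
    and bij: "bij_betw \<phi> (carrier A) T"
    using iso unfolding hemiring_isomorphic_def by auto
  obtain v0 where v0: "v0 \<in> carrier V" "v0 \<noteq> \<zero>\<^bsub>V\<^esub>" using nz V.zero_closed by blast
  have sub: "subgroup T (add_monoid (End_ring D V))"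
    and Tmult: "\<And>s t. s \<in> T \<Longrightarrow> t \<in> T \<Longrightarrow> s \<otimes>\<^bsub>End_ring D V\<^esub> t \<in> T"
    and Tdense: "\<And>n v w. lin_independent D V n v \<Longrightarrow> w \<in> {..<n} \<rightarrow> carrier V \<Longrightarrow>
      \<exists>t\<in>T. \<forall>i<n. t (v i) = w i"
    using dense unfolding dense_subring_def by blast+
  have TE: "T \<subseteq> carrier (End_ring D V)" using subgroup.subset[OF sub] by simp
  have "\<exists>a. a \<in> carrier A \<and> \<phi> a v0 = v" if "v \<in> carrier V" for v
  proof -
    obtain t where "t \<in> T" "t v0 = v"
      using Tdense[OF lin_independent_single[OF v0], of "\<lambda>_. v"] \<open>v \<in> carrier V\<close> by auto
    then show ?thesis using bij unfolding bij_betw_def by auto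
  qed
  then obtain g where g: "\<And>v. v \<in> carrier V \<Longrightarrow> \<phi> (g v) v0 = v" by metis
  have inj_g: "inj_on g (carrier V)" by (rule inj_onI) (metis g)
  define h where "h d = g (d \<odot>\<^bsub>V\<^esub> v0)" for d
  have inj_h: "inj_on h (carrier D)"
  proof (rule inj_onI)
    fix d e assume de: "d \<in> carrier D" "e \<in> carrier D" "h d = h e"
    then have "d \<odot>\<^bsub>V\<^esub> v0 = e \<odot>\<^bsub>V\<^esub> v0"
      unfolding h_def using v0 scale_closed inj_g by (auto dest: inj_onD)
    then have "(d \<ominus>\<^bsub>D\<^esub> e) \<odot>\<^bsub>V\<^esub> v0 = (e \<ominus>\<^bsub>D\<^esub> e) \<odot>\<^bsub>V\<^esub> v0"
      using de v0 by (simp add: scale_add_scalar D.minus_eq del: D.r_neg)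
    also have "\<dots> = \<zero>\<^bsub>V\<^esub>" using de v0 by (simp add: D.minus_eq D.r_neg scale_null)
    finally have "d \<ominus>\<^bsub>D\<^esub> e = \<zero>\<^bsub>D\<^esub>"
      using de v0 by (intro scale_eq_zero) auto
    then have "(d \<ominus>\<^bsub>D\<^esub> e) \<oplus>\<^bsub>D\<^esub> e = e" using de(2) by simp
    then show "d = e"
      using de(1,2) by (simp add: D.minus_eq D.a_assoc D.l_neg)
  qed
  define D' where "D' = transport_ring h D"
  define V' where "V' = transport_module D h g V"
  interpret W: right_vector_space D' V'
    unfolding D'_def V'_def by (rule right_vector_space_transport[OF vs inj_h inj_g])
  interpret F: ring "End_ring D' V'" by (rule W.ring_End_ring)
  note D's = transport_ring_simps[of h D, folded D'_def]
  note V's = transport_module_simps[where R = D and h = h and g = g and M = V, folded V'_def]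
  note D's(4,5)[OF inj_h, simp] D's(1-3)[simp] V's(1,2)[simp] V's(3)[OF inj_g, simp]
    V's(4)[OF inj_h inj_g, simp]
    inj_on_eq_iff[OF inj_h, simp] inj_on_eq_iff[OF inj_g, simp]
  define k where "k = inv_into (carrier V) g"
  have kg [simp]: "k (g v) = v" if "v \<in> carrier V" for v
    unfolding k_def by (rule inv_into_f_f[OF inj_g that])
  have gk [simp]: "g (k x) = x" and kc [simp]: "k x \<in> carrier V" if "x \<in> carrier V'" for x
    using that by auto
  define \<Phi> where "\<Phi> t = (\<lambda>x\<in>carrier V'. g (t (k x)))" for t
  have \<Phi>E: "\<Phi> t \<in> carrier (End_ring D' V')" if "t \<in> carrier (End_ring D V)" for t
    using that by (auto simp: \<Phi>_def End_ring_def PiE_iff scale_closed)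
  have \<Phi>_add: "\<Phi> (s \<oplus>\<^bsub>End_ring D V\<^esub> t) = \<Phi> s \<oplus>\<^bsub>End_ring D' V'\<^esub> \<Phi> t"
    and \<Phi>_mult: "\<Phi> (s \<otimes>\<^bsub>End_ring D V\<^esub> t) = \<Phi> s \<otimes>\<^bsub>End_ring D' V'\<^esub> \<Phi> t"
    if "s \<in> carrier (End_ring D V)" "t \<in> carrier (End_ring D V)" for s t
    using that by (auto simp: \<Phi>_def End_ring_def PiE_iff fun_eq_iff)
  have \<Phi>_zero: "\<Phi> \<zero>\<^bsub>End_ring D V\<^esub> = \<zero>\<^bsub>End_ring D' V'\<^esub>"
    by (auto simp: \<Phi>_def End_ring_def fun_eq_iff)
  have inj_\<Phi>: "inj_on \<Phi> (carrier (End_ring D V))"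
  proof (rule inj_onI)
    fix s t assume st: "s \<in> carrier (End_ring D V)" "t \<in> carrier (End_ring D V)" "\<Phi> s = \<Phi> t"
    show "s = t"
    proof (rule extensionalityI[of _ "carrier V"])
      fix v assume v: "v \<in> carrier V"
      have "\<Phi> s (g v) = \<Phi> t (g v)" using st by simp
      moreover have "s v \<in> carrier V" "t v \<in> carrier V"
        using st v by (auto simp: End_ring_def)
      ultimately show "s v = t v" using v by (simp add: \<Phi>_def)
    qed (use st in \<open>auto simp: End_ring_def PiE_iff\<close>)
  qed
  define T' where "T' = \<Phi> ` T"
  have "group_hom (add_monoid (End_ring D V)) (add_monoid (End_ring D' V')) \<Phi>"
    using \<Phi>E \<Phi>_add by (intro group_hom.intro group_hom_axioms.intro E.a_group F.a_group homI) auto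
  then have "subgroup T' (add_monoid (End_ring D' V'))"
    unfolding T'_def using sub by (rule group_hom.subgroup_img_is_subgroup)
  moreover have "s \<otimes>\<^bsub>End_ring D' V'\<^esub> t \<in> T'" if "s \<in> T'" "t \<in> T'" for s t
    using that TE Tmult \<Phi>_mult unfolding T'_def by (auto simp: subset_iff image_iff) metis
  moreover have "\<exists>t\<in>T'. \<forall>i<n. t (v i) = w i"
    if v: "lin_independent D' V' n v" and w: "w \<in> {..<n} \<rightarrow> carrier V'" for n v w
  proof -
    have vV: "v i \<in> carrier V'" if "i < n" for i
      using v that by (auto simp: lin_independent_def simp del: V's(1))
    have wV: "w i \<in> carrier V'" if "i < n" for i
      using w that by auto
    have indep: "b i = \<zero>\<^bsub>D'\<^esub>" if "b \<in> {..<n} \<rightarrow> carrier D'"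
      "(\<Oplus>\<^bsub>V'\<^esub>i\<in>{..<n}. b i \<odot>\<^bsub>V'\<^esub> v i) = \<zero>\<^bsub>V'\<^esub>" "i < n" for b i
      using v that unfolding lin_independent_def by blast
    have kv: "k (v i) \<in> carrier V" "g (k (v i)) = v i" if "i < n" for i
      using kc[OF vV[OF that]] gk[OF vV[OF that]] by blast+
    have fs: "(\<Oplus>\<^bsub>V'\<^esub>i\<in>{..<m}. h (c i) \<odot>\<^bsub>V'\<^esub> v i) = g (\<Oplus>\<^bsub>V\<^esub>i\<in>{..<m}. c i \<odot>\<^bsub>V\<^esub> k (v i)) \<and>
        (\<Oplus>\<^bsub>V\<^esub>i\<in>{..<m}. c i \<odot>\<^bsub>V\<^esub> k (v i)) \<in> carrier V"
      if "m \<le> n" "\<And>i. i < n \<Longrightarrow> c i \<in> carrier D" for m c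
      using that(1)
    proof (induction m)
      case (Suc m)
      have m: "c i \<odot>\<^bsub>V\<^esub> k (v i) \<in> carrier V" "h (c i) \<odot>\<^bsub>V'\<^esub> v i = g (c i \<odot>\<^bsub>V\<^esub> k (v i))" if "i \<le> m" for i
      proof -
        have i: "i < n" using that Suc.prems by simp
        then show "c i \<odot>\<^bsub>V\<^esub> k (v i) \<in> carrier V"
          using \<open>\<And>i. i < n \<Longrightarrow> c i \<in> carrier D\<close> kv scale_closed by blast
        have "h (c i) \<odot>\<^bsub>V'\<^esub> g (k (v i)) = g (c i \<odot>\<^bsub>V\<^esub> k (v i))"
          using \<open>\<And>i. i < n \<Longrightarrow> c i \<in> carrier D\<close> i kv by (intro V's(4)[OF inj_h inj_g])
        then show "h (c i) \<odot>\<^bsub>V'\<^esub> v i = g (c i \<odot>\<^bsub>V\<^esub> k (v i))" using kv i by simp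
      qed
      have "(\<Oplus>\<^bsub>V'\<^esub>i\<in>{..<Suc m}. h (c i) \<odot>\<^bsub>V'\<^esub> v i) =
          h (c m) \<odot>\<^bsub>V'\<^esub> v m \<oplus>\<^bsub>V'\<^esub> (\<Oplus>\<^bsub>V'\<^esub>i\<in>{..<m}. h (c i) \<odot>\<^bsub>V'\<^esub> v i)"
        unfolding lessThan_Suc by (rule W.V.finsum_insert) (use m in \<open>auto\<close>)
      moreover have "(\<Oplus>\<^bsub>V\<^esub>i\<in>{..<Suc m}. c i \<odot>\<^bsub>V\<^esub> k (v i)) =
          c m \<odot>\<^bsub>V\<^esub> k (v m) \<oplus>\<^bsub>V\<^esub> (\<Oplus>\<^bsub>V\<^esub>i\<in>{..<m}. c i \<odot>\<^bsub>V\<^esub> k (v i))"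
        unfolding lessThan_Suc by (rule V.finsum_insert) (use m in \<open>auto\<close>)
      ultimately show ?case using Suc m by simp
    qed simp
    have "lin_independent D V n (\<lambda>i. k (v i))"
      unfolding lin_independent_def
    proof (intro conjI ballI impI allI)
      fix c i assume c: "c \<in> {..<n} \<rightarrow> carrier D"
        and z: "(\<Oplus>\<^bsub>V\<^esub>i\<in>{..<n}. c i \<odot>\<^bsub>V\<^esub> k (v i)) = \<zero>\<^bsub>V\<^esub>" and i: "i < n"
      have cD: "\<And>i. i < n \<Longrightarrow> c i \<in> carrier D" using c by auto
      have "(\<lambda>i. h (c i)) \<in> {..<n} \<rightarrow> carrier D'" using cD by auto
      moreover have "(\<Oplus>\<^bsub>V'\<^esub>i\<in>{..<n}. h (c i) \<odot>\<^bsub>V'\<^esub> v i) = \<zero>\<^bsub>V'\<^esub>" using fs[of n c] cD z by simp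
      ultimately have "h (c i) = \<zero>\<^bsub>D'\<^esub>"
        using i by (rule indep)
      then show "c i = \<zero>\<^bsub>D\<^esub>" using cD i by simp
    qed (use vV kc in auto)
    then obtain t where t: "t \<in> T" "\<And>i. i < n \<Longrightarrow> t (k (v i)) = k (w i)"
      using Tdense[of n "\<lambda>i. k (v i)" "\<lambda>i. k (w i)"] wV kc by blast
    have "\<Phi> t (v i) = w i" if "i < n" for i
      using t(2)[OF that] vV[OF that] gk[OF wV[OF that]] by (simp add: \<Phi>_def del: V's(1))
    then show ?thesis using t(1) unfolding T'_def by blast
  qed
  ultimately have "dense_subring D' V' T'" unfolding dense_subring_def by blast
  moreover have "carrier V' \<noteq> {\<zero>\<^bsub>V'\<^esub>}"
    using v0 by (auto dest!: equalityD1)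
  moreover have "hemiring_isomorphic A (End_ring D' V' \<lparr>carrier := T'\<rparr>)"
    unfolding hemiring_isomorphic_def
  proof (rule bexI[of _ "\<Phi> \<circ> \<phi>"])
    show "bij_betw (\<Phi> \<circ> \<phi>) (carrier A) (carrier (End_ring D' V'\<lparr>carrier := T'\<rparr>))"
      using bij inj_\<Phi> TE unfolding T'_def
      by (auto intro!: bij_betw_trans[OF bij] inj_on_imp_bij_betw intro: inj_on_subset)
    have "\<phi> a \<in> T" if "a \<in> carrier A" for a using bij that by (auto simp: bij_betw_def)
    moreover from this have "\<phi> a \<in> carrier (End_ring D V)" if "a \<in> carrier A" for a using TE that by blast
    ultimately show "\<Phi> \<circ> \<phi> \<in> hemiring_hom A (End_ring D' V'\<lparr>carrier := T'\<rparr>)"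
      using hom by (auto simp: hemiring_hom_def hom_def T'_def \<Phi>_add \<Phi>_mult \<Phi>_zero)
  qed
  ultimately show ?thesis
    unfolding isomorphic_to_dense_subring_def using W.right_vector_space_axioms by blast
qed

lemma diff_ring_transport:
  fixes S :: "('s, 'z) ring_scheme"
  assumes S: "hemiring S" and g: "inj_on g (carrier S)"
  shows "hemiring_isomorphic (diff_ring (transport_ring g S)) (diff_ring S)"
proof -
  interpret hemiring S by fact
  define S' where "S' = transport_ring g S"
  interpret S': hemiring S' unfolding S'_def by (rule hemiring_transport[OF S g])
  note S's = transport_ring_simps[of g S, folded S'_def]
  note [simp] = S's(1,2) S's(4,5)[OF g] inj_on_eq_iff[OF g] m_closed
  define k where "k = inv_into (carrier S) g"
  have kg [simp]: "k (g v) = v" if "v \<in> carrier S" for v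
    unfolding k_def using g that by simp
  have rel: "((g a, g b), (g c, g d)) \<in> diff_rel S' \<longleftrightarrow> ((a, b), (c, d)) \<in> diff_rel S"
    if "a \<in> carrier S" "b \<in> carrier S" "c \<in> carrier S" "d \<in> carrier S" for a b c d
    using that by (simp add: diff_rel_def)
  define \<Psi> where "\<Psi> X = map_prod k k ` X" for X
  have \<Psi>: "\<Psi> (diff_class S' (g a) (g b)) = diff_class S a b"
    if ab: "a \<in> carrier S" "b \<in> carrier S" for a b
  proof (intro subset_antisym subsetI)
    fix x assume "x \<in> \<Psi> (diff_class S' (g a) (g b))"
    then obtain y where y: "x = map_prod k k y" "((g a, g b), y) \<in> diff_rel S'"
      unfolding \<Psi>_def diff_class_def by auto
    then have "y \<in> carrier S' \<times> carrier S'" unfolding diff_rel_def by blast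
    then obtain c d where cd: "c \<in> carrier S" "d \<in> carrier S" "y = (g c, g d)"
      by auto
    then show "x \<in> diff_class S a b"
      using y rel ab by (simp add: diff_class_def)
  next
    fix x assume "x \<in> diff_class S a b"
    then have "((a, b), x) \<in> diff_rel S" unfolding diff_class_def by simp
    moreover from this have "x \<in> carrier S \<times> carrier S" unfolding diff_rel_def by blast
    ultimately obtain c d where cd: "c \<in> carrier S" "d \<in> carrier S" "x = (c, d)"
      "((a, b), (c, d)) \<in> diff_rel S"
      by auto
    then have "(g c, g d) \<in> diff_class S' (g a) (g b)"
      using rel ab by (simp add: diff_class_def)
    then show "x \<in> \<Psi> (diff_class S' (g a) (g b))"
      unfolding \<Psi>_def using cd by (auto intro!: image_eqI[of _ _ "(g c, g d)"])
  qed
  have cases: "\<exists>a\<in>carrier S. \<exists>b\<in>carrier S. X = diff_class S' (g a) (g b)"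
    if "X \<in> carrier (diff_ring S')" for X
    using S'.diff_ring_cases[OF that] by (metis S's(1) imageE)
  have "\<Psi> \<in> hemiring_hom (diff_ring S') (diff_ring S)"
    unfolding hemiring_hom_def hom_def
    by (auto dest!: cases simp: \<Psi> diff_class_carrier diff_ring_add diff_ring_mult
        S'.diff_ring_add S'.diff_ring_mult diff_ring_zero S'.diff_ring_zero)
  moreover have "bij_betw \<Psi> (carrier (diff_ring S')) (carrier (diff_ring S))"
    unfolding bij_betw_def
  proof (intro conjI inj_onI)
    fix X Y assume XY: "X \<in> carrier (diff_ring S')" "Y \<in> carrier (diff_ring S')" "\<Psi> X = \<Psi> Y"
    obtain a b where X: "a \<in> carrier S" "b \<in> carrier S" "X = diff_class S' (g a) (g b)"
      using cases[OF XY(1)] by blast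
    obtain c d where Y: "c \<in> carrier S" "d \<in> carrier S" "Y = diff_class S' (g c) (g d)"
      using cases[OF XY(2)] by blast
    have "((g a, g b), (g c, g d)) \<in> diff_rel S'"
      using XY(3) X Y by (simp add: \<Psi> diff_class_eq_iff rel)
    then show "X = Y"
      using X Y S'.diff_class_eq_iff[of "g a" "g b" "g c" "g d"] by simp
  next
    show "\<Psi> ` carrier (diff_ring S') = carrier (diff_ring S)"
    proof (intro subset_antisym subsetI)
      fix X assume "X \<in> carrier (diff_ring S)"
      then obtain a b where "a \<in> carrier S" "b \<in> carrier S" "X = diff_class S a b"
        by (rule diff_ring_cases)
      then show "X \<in> \<Psi> ` carrier (diff_ring S')"
        using S'.diff_class_carrier by (intro image_eqI[of _ _ "diff_class S' (g a) (g b)"]) (auto simp: \<Psi>)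
    qed (auto dest!: cases simp: \<Psi> diff_class_carrier)
  qed
  ultimately show ?thesis unfolding hemiring_isomorphic_def S'_def by blast
qed

text \<open>
  A semiisomorphic image of a hemiring on the type \<open>'a\<close> may be taken on the type \<open>'a\<close> as well.
\<close>

lemma semiisomorphic_witness:
  fixes R :: "('a, 'c) ring_scheme" and S :: "('s, 'z) ring_scheme"
  assumes S: "hemiring S" "add_cancellative S" and semi: "semiisomorphic R S"
    and rep: "isomorphic_to_dense_subring (diff_ring S)"
  shows "\<exists>S' :: 'a ring. hemiring S' \<and> add_cancellative S' \<and> semiisomorphic R S' \<and>
    isomorphic_to_dense_subring (diff_ring S')"
proof -
  interpret hemiring S by fact
  obtain f where f: "f \<in> hemiring_hom R S" "f ` carrier R = carrier S"
    "{a \<in> carrier R. f a = \<zero>\<^bsub>S\<^esub>} = {\<zero>\<^bsub>R\<^esub>}"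
    using semi unfolding semiisomorphic_def by blast
  define g where "g = inv_into (carrier R) f"
  have inj: "inj_on g (carrier S)" unfolding g_def f(2)[symmetric] by (rule inj_on_inv_into) simp
  define S' where "S' = transport_ring g S"
  note S's = transport_ring_simps[of g S, folded S'_def]
  note [simp] = S's(1,2) S's(4,5)[OF inj] inj_on_eq_iff[OF inj] m_closed
  have fS: "f a \<in> carrier S" if "a \<in> carrier R" for a using f(2) that by blast
  have "hemiring S'" unfolding S'_def by (rule hemiring_transport[OF S(1) inj])
  moreover have "add_cancellative S'"
    using S(2) unfolding add_cancellative_def by auto
  moreover have "semiisomorphic R S'"
    unfolding semiisomorphic_def
  proof (rule bexI[of _ "g \<circ> f"], intro conjI)
    show "(g \<circ> f) ` carrier R = carrier S'" unfolding f(2)[symmetric] S's(1) by (rule image_comp[symmetric])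
    have "{a \<in> carrier R. (g \<circ> f) a = \<zero>\<^bsub>S'\<^esub>} = {a \<in> carrier R. f a = \<zero>\<^bsub>S\<^esub>}" using fS by auto
    then show "{a \<in> carrier R. (g \<circ> f) a = \<zero>\<^bsub>S'\<^esub>} = {\<zero>\<^bsub>R\<^esub>}" using f(3) by simp
    show "g \<circ> f \<in> hemiring_hom R S'" using f(1) fS by (auto simp: hemiring_hom_def hom_def)
  qed
  moreover have "isomorphic_to_dense_subring (diff_ring S')"
  proof -
    obtain D :: "('s \<times> 's) set ring" and V :: "(('s \<times> 's) set, ('s \<times> 's) set) module" and T
      where DV: "right_vector_space D V" "carrier V \<noteq> {\<zero>\<^bsub>V\<^esub>}" "dense_subring D V T"
      and iso: "hemiring_isomorphic (diff_ring S) (End_ring D V \<lparr>carrier := T\<rparr>)"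
      using rep unfolding isomorphic_to_dense_subring_def by blast
    obtain p where p: "p \<in> hemiring_hom (diff_ring S') (diff_ring S)"
      "bij_betw p (carrier (diff_ring S')) (carrier (diff_ring S))"
      using diff_ring_transport[OF S(1) inj] unfolding S'_def hemiring_isomorphic_def by blast
    obtain q where q: "q \<in> hemiring_hom (diff_ring S) (End_ring D V \<lparr>carrier := T\<rparr>)"
      "bij_betw q (carrier (diff_ring S)) T"
      using iso unfolding hemiring_isomorphic_def by auto
    have "bij_betw (q \<circ> p) (carrier (diff_ring S')) T"
      using bij_betw_trans p(2) q(2) by blast
    moreover have "q \<circ> p \<in> hemiring_hom (diff_ring S') (End_ring D V \<lparr>carrier := T\<rparr>)"
      using p(1) q(1) unfolding hemiring_hom_def hom_def by (auto simp: Pi_iff)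
    ultimately show ?thesis
      by (intro isomorphic_to_dense_subringI[OF DV]) (auto simp: hemiring_isomorphic_def)
  qed
  ultimately show ?thesis by blast
qed

end

theory Submission
  imports Defs
begin

text \<open>
  The theorem is Jacobson's density theorem, carried over to hemirings by passing to differences.

  Let \<open>M\<close> be a faithful irreducible semimodule over \<open>R\<close>.  Faithfulness only says that no nonzero
  element acts as zero; two different elements may still act in the same way.  Identifying such
  elements, that is, replacing \<open>R\<close> by the hemiring \<open>S\<close> of the maps \<open>m \<mapsto> r m\<close>, collapses only \<open>0\<close>
  to \<open>0\<close>, so that \<open>R \<rightarrow> S\<close> is a semiisomorphism (\<open>semiisomorphic_operator_hemiring\<close>), and \<open>S\<close> is
  additively cancellative because \<open>M\<close> is.  The ring of differences of \<open>S\<close> acts on the group of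
  differences \<open>G\<close> of \<open>M\<close> by \<open>(a - b)(p - q) = (a p + b q) - (a q + b p)\<close>.  This action is faithful
  because elements of \<open>S\<close> are determined by their action on \<open>M\<close> (\<open>act_eq_iff\<close>), and the equation
  that defines irreducibility, read in \<open>G\<close>, says \<open>m = (r\<^sub>2 - r\<^sub>1)(m\<^sub>1 - m\<^sub>2)\<close>: every nonzero element
  of \<open>G\<close> is moved to every element coming from \<open>M\<close>, hence to every element (\<open>act_transitive\<close>).
  So \<open>G\<close> is a simple faithful module over the ring of differences, the endomorphisms of this module
  form a division ring by Schur's lemma (\<open>commutant_division_ring\<close>), and the density theorem
  (\<open>density\<close>) applies.

  Conversely, let the ring of differences of \<open>S\<close> be dense on a nonzero vector space \<open>V\<close>.  Density for
  a single nonzero vector \<open>m\<^sub>1 - m\<^sub>2\<close> is the irreducibility of \<open>V\<close> as a semimodule over \<open>S\<close>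
  (\<open>primitive_diff_dense\<close>).  Restriction along a semiisomorphism \<open>R \<rightarrow> S\<close> keeps irreducibility,
  because the map is onto, and faithfulness, because only \<open>0\<close> is mapped to \<open>0\<close>
  (\<open>primitive_if_semiisomorphic\<close>).
\<close>

section \<open>The density theorem\<close>

text \<open>
  A simple module over a ring without identity, the ring being given by the maps through which
  it acts.  Transitivity includes that no nonzero vector is killed by all operators, which simplicity
  alone would not give in the absence of an identity.
\<close>

locale irreducible_operators = abelian_group V for V (structure) +
  fixes T :: "('v \<Rightarrow> 'v) set"
  assumes nontrivial: "carrier V \<noteq> {\<zero>}"
    and T_maps: "t \<in> T \<Longrightarrow> t \<in> carrier V \<rightarrow>\<^sub>E carrier V"
    and T_additive: "\<lbrakk>t \<in> T; v \<in> carrier V; w \<in> carrier V\<rbrakk> \<Longrightarrow> t (v \<oplus> w) = t v \<oplus> t w"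
    and T_add: "\<lbrakk>s \<in> T; t \<in> T\<rbrakk> \<Longrightarrow> (\<lambda>v\<in>carrier V. s v \<oplus> t v) \<in> T"
    and T_minus: "t \<in> T \<Longrightarrow> (\<lambda>v\<in>carrier V. \<ominus> t v) \<in> T"
    and T_comp: "\<lbrakk>s \<in> T; t \<in> T\<rbrakk> \<Longrightarrow> (\<lambda>v\<in>carrier V. s (t v)) \<in> T"
    and transitive: "\<lbrakk>x \<in> carrier V; x \<noteq> \<zero>; y \<in> carrier V\<rbrakk> \<Longrightarrow> \<exists>t\<in>T. t x = y"
begin

text \<open>
  Commuting maps serve as scalars written on the right of vectors, so that the image of \<open>v\<close> under
  \<open>d\<close> is \<open>v d\<close>.  Since \<open>v (d e) = (v d) e\<close>, the product \<open>d e\<close> applies \<open>d\<close> first: it is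
  the opposite of composition.
\<close>

definition commutant :: "('v \<Rightarrow> 'v) ring" where
  "commutant =
    \<lparr>carrier = {d \<in> carrier V \<rightarrow>\<^sub>E carrier V.
       (\<forall>v\<in>carrier V. \<forall>w\<in>carrier V. d (v \<oplus> w) = d v \<oplus> d w) \<and>
       (\<forall>t\<in>T. \<forall>v\<in>carrier V. d (t v) = t (d v))},
     mult = (\<lambda>d e. \<lambda>v\<in>carrier V. e (d v)),
     one = (\<lambda>v\<in>carrier V. v),
     zero = (\<lambda>v\<in>carrier V. \<zero>),
     add = (\<lambda>d e. \<lambda>v\<in>carrier V. d v \<oplus> e v)\<rparr>"

definition space :: "('v \<Rightarrow> 'v, 'v) module" where
  "space = \<lparr>carrier = carrier V, mult = undefined, one = undefined, zero = \<zero>, add = (\<oplus>),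
    smult = (\<lambda>d v. d v)\<rparr>"

lemma space_simps [simp]:
  "carrier space = carrier V" "\<zero>\<^bsub>space\<^esub> = \<zero>" "v \<oplus>\<^bsub>space\<^esub> w = v \<oplus> w" "d \<odot>\<^bsub>space\<^esub> v = d v"
  by (simp_all add: space_def)

lemma minus_zeroD:
  assumes "x \<in> carrier V" "y \<in> carrier V" "x \<ominus> y = \<zero>"
  shows "x = y"
proof -
  have "x = x \<ominus> y \<oplus> y" using assms(1,2) by (simp add: minus_eq a_assoc l_neg)
  then show ?thesis using assms by simp
qed

lemma additive_zero:
  assumes "f \<in> carrier V \<rightarrow> carrier V" "\<And>v w. \<lbrakk>v \<in> carrier V; w \<in> carrier V\<rbrakk> \<Longrightarrow> f (v \<oplus> w) = f v \<oplus> f w"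
  shows "f \<zero> = \<zero>"
  by (metis assms PiE add.r_cancel_one' l_zero zero_closed)

lemma additive_minus:
  assumes f: "f \<in> carrier V \<rightarrow> carrier V" "\<And>v w. \<lbrakk>v \<in> carrier V; w \<in> carrier V\<rbrakk> \<Longrightarrow> f (v \<oplus> w) = f v \<oplus> f w"
    and v: "v \<in> carrier V"
  shows "f (\<ominus> v) = \<ominus> f v"
proof -
  have "f v \<in> carrier V" "f (\<ominus> v) \<in> carrier V" using f(1) v by auto
  moreover have "f (\<ominus> v) \<oplus> f v = \<zero>"
    using f(2)[of "\<ominus> v" v] v additive_zero[OF f] by (simp add: l_neg)
  ultimately show ?thesis by (simp add: minus_equality)
qed

lemma T_closed [simp]: "\<lbrakk>t \<in> T; v \<in> carrier V\<rbrakk> \<Longrightarrow> t v \<in> carrier V"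
  using T_maps by (auto simp: PiE_iff)

lemma T_zero [simp]: "t \<in> T \<Longrightarrow> t \<zero> = \<zero>"
  by (rule additive_zero) (auto simp: T_additive)

lemma T_uminus: "\<lbrakk>t \<in> T; v \<in> carrier V\<rbrakk> \<Longrightarrow> t (\<ominus> v) = \<ominus> t v"
  by (rule additive_minus) (auto simp: T_additive)

lemma obtain_nonzero: obtains v where "v \<in> carrier V" "v \<noteq> \<zero>"
  using nontrivial zero_closed by blast

lemma commutant_iff:
  "d \<in> carrier commutant \<longleftrightarrow> d \<in> carrier V \<rightarrow>\<^sub>E carrier V \<and>
    (\<forall>v\<in>carrier V. \<forall>w\<in>carrier V. d (v \<oplus> w) = d v \<oplus> d w) \<and>
    (\<forall>t\<in>T. \<forall>v\<in>carrier V. d (t v) = t (d v))"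
  by (simp add: commutant_def)

lemma commutant_closed [simp]: "\<lbrakk>d \<in> carrier commutant; v \<in> carrier V\<rbrakk> \<Longrightarrow> d v \<in> carrier V"
  and commutant_additive: "\<lbrakk>d \<in> carrier commutant; v \<in> carrier V; w \<in> carrier V\<rbrakk> \<Longrightarrow> d (v \<oplus> w) = d v \<oplus> d w"
  and commutant_commutes: "\<lbrakk>d \<in> carrier commutant; t \<in> T; v \<in> carrier V\<rbrakk> \<Longrightarrow> d (t v) = t (d v)"
  by (auto simp: commutant_iff PiE_iff)

lemma commutant_eqI:
  assumes "d \<in> carrier commutant" "e \<in> carrier commutant" "\<And>v. v \<in> carrier V \<Longrightarrow> d v = e v"
  shows "d = e"
  by (rule extensionalityI[of _ "carrier V"]) (use assms in \<open>auto simp: commutant_iff PiE_iff\<close>)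

lemma commutant_ops [simp]:
  "\<zero>\<^bsub>commutant\<^esub> = (\<lambda>v\<in>carrier V. \<zero>)" "\<one>\<^bsub>commutant\<^esub> = (\<lambda>v\<in>carrier V. v)"
  "d \<oplus>\<^bsub>commutant\<^esub> e = (\<lambda>v\<in>carrier V. d v \<oplus> e v)" "d \<otimes>\<^bsub>commutant\<^esub> e = (\<lambda>v\<in>carrier V. e (d v))"
  by (simp_all add: commutant_def)

lemma commutant_ring: "ring commutant"
proof -
  have ops: "(\<lambda>v\<in>carrier V. \<zero>) \<in> carrier commutant" "(\<lambda>v\<in>carrier V. v) \<in> carrier commutant"
    by (auto simp: commutant_iff)
  have add: "(\<lambda>v\<in>carrier V. d v \<oplus> e v) \<in> carrier commutant"
    and mult: "(\<lambda>v\<in>carrier V. e (d v)) \<in> carrier commutant"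
    if "d \<in> carrier commutant" "e \<in> carrier commutant" for d e
    using that
    by (auto simp: commutant_iff[of "restrict _ _"] commutant_additive commutant_commutes T_additive a_ac)
  have neg: "(\<lambda>v\<in>carrier V. \<ominus> d v) \<in> carrier commutant" if "d \<in> carrier commutant" for d
    using that
    by (auto simp: commutant_iff[of "restrict _ _"] commutant_additive commutant_commutes T_uminus minus_add)
  note ops [simp] add [simp] mult [simp]
  show ?thesis
  proof (intro ringI abelian_groupI monoidI)
    fix d assume d: "d \<in> carrier commutant"
    show "\<exists>e\<in>carrier commutant. e \<oplus>\<^bsub>commutant\<^esub> d = \<zero>\<^bsub>commutant\<^esub>"
      using neg[OF d] d by (intro bexI[of _ "\<lambda>v\<in>carrier V. \<ominus> d v"]) (auto simp: l_neg fun_eq_iff)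
  next
    fix d assume d: "d \<in> carrier commutant"
    then have "d v = undefined" if "v \<notin> carrier V" for v
      using that by (auto simp: commutant_iff PiE_iff extensional_def)
    then show "\<zero>\<^bsub>commutant\<^esub> \<oplus>\<^bsub>commutant\<^esub> d = d"
      "\<one>\<^bsub>commutant\<^esub> \<otimes>\<^bsub>commutant\<^esub> d = d" "d \<otimes>\<^bsub>commutant\<^esub> \<one>\<^bsub>commutant\<^esub> = d"
      using d by (auto simp: fun_eq_iff)
  qed (auto simp: a_ac commutant_additive fun_eq_iff)
qed

text \<open>
  Schur's lemma.  If a commuting map \<open>d\<close> killed some \<open>x \<noteq> 0\<close>, it would kill every \<open>t x\<close>, hence every
  vector.  Its image contains with \<open>d v \<noteq> 0\<close> also every \<open>t (d v) = d (t v)\<close>, hence every vector.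
\<close>

lemma commutant_bij:
  assumes d: "d \<in> carrier commutant" "d \<noteq> \<zero>\<^bsub>commutant\<^esub>"
  shows "bij_betw d (carrier V) (carrier V)"
proof -
  interpret D: ring commutant by (rule commutant_ring)
  obtain v where v: "v \<in> carrier V" "d v \<noteq> \<zero>"
    using d commutant_eqI[OF d(1) D.zero_closed] by auto
  have ker: "x = \<zero>" if x: "x \<in> carrier V" "d x = \<zero>" for x
  proof (rule ccontr)
    assume "x \<noteq> \<zero>"
    then obtain t where "t \<in> T" "t x = v" using transitive x v by blast
    then show False using v x commutant_commutes[OF d(1), of t x] by simp
  qed
  have "inj_on d (carrier V)"
  proof (rule inj_onI)
    fix x y assume xy: "x \<in> carrier V" "y \<in> carrier V" "d x = d y"
    have "d (x \<ominus> y) = d x \<oplus> d (\<ominus> y)"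
      using xy d by (simp add: minus_eq commutant_additive)
    also have "d (\<ominus> y) = \<ominus> d y"
      using xy d by (intro additive_minus) (auto simp: commutant_additive)
    finally have "d (x \<ominus> y) = \<zero>" using xy d by (simp add: r_neg)
    then show "x = y" using ker[of "x \<ominus> y"] minus_zeroD[of x y] xy by simp
  qed
  moreover have "d ` carrier V = carrier V"
  proof (intro subset_antisym subsetI)
    fix y assume "y \<in> carrier V"
    then obtain t where t: "t \<in> T" "t (d v) = y" using transitive[of "d v" y] d v by auto
    then have "y = d (t v)" using commutant_commutes[OF d(1)] v by simp
    then show "y \<in> d ` carrier V" using t v by simp
  qed (use d in auto)
  ultimately show ?thesis by (simp add: bij_betw_def)
qed

lemma commutant_division_ring: "division_ring commutant"
proof -
  interpret D: ring commutant by (rule commutant_ring)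
  have "\<one>\<^bsub>commutant\<^esub> \<noteq> \<zero>\<^bsub>commutant\<^esub>"
    using obtain_nonzero by (metis commutant_ops(1,2) restrict_apply')
  then have "\<zero>\<^bsub>commutant\<^esub> \<notin> Units commutant"
    unfolding Units_def using D.r_null by fastforce
  moreover have "d \<in> Units commutant" if d: "d \<in> carrier commutant" "d \<noteq> \<zero>\<^bsub>commutant\<^esub>" for d
  proof -
    have bij: "bij_betw d (carrier V) (carrier V)" by (rule commutant_bij[OF d])
    define e where "e = (\<lambda>v\<in>carrier V. inv_into (carrier V) d v)"
    have ec: "e v \<in> carrier V" and de: "d (e v) = v" if "v \<in> carrier V" for v
      using that bij unfolding e_def bij_betw_def
      by (auto simp: f_inv_into_f) (metis inv_into_into)
    have ed: "e (d v) = v" if "v \<in> carrier V" for v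
      using that bij d unfolding e_def bij_betw_def by simp
    have "e (v \<oplus> w) = e v \<oplus> e w" if "v \<in> carrier V" "w \<in> carrier V" for v w
      using ed[of "e v \<oplus> e w"] d(1) ec de that by (simp add: commutant_additive)
    moreover have "e (t v) = t (e v)" if "t \<in> T" "v \<in> carrier V" for t v
      using ed[of "t (e v)"] commutant_commutes[OF d(1) that(1), of "e v"] ec de that by simp
    ultimately have "e \<in> carrier commutant"
      using ec unfolding commutant_iff by (auto simp: e_def)
    then show ?thesis
      using d(1) ed de unfolding Units_def by (auto intro!: bexI[of _ e] simp: fun_eq_iff)
  qed
  ultimately show ?thesis
    by (intro division_ring.intro D.ring_axioms division_ring_axioms.intro) (auto simp: Units_def)
qed

lemma space_vector_space: "right_vector_space commutant space"
proof -
  have "abelian_group space"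
    by (rule abelian_groupI) (auto simp: a_ac intro: l_neg)
  then show ?thesis
    by (intro right_vector_space.intro right_vector_space_axioms.intro commutant_division_ring)
      (auto simp: commutant_additive)
qed

sublocale vs: right_vector_space commutant space
  by (rule space_vector_space)

text \<open>
  This is the heart of the density theorem.  In the induction step let \<open>l\<close> range over the operators
  that kill the first \<open>n\<close> vectors.  If all of them kill \<open>v n\<close> as well, they kill \<open>x\<close>, and the
  induction hypothesis applies to \<open>x\<close>.  Otherwise the vectors \<open>l (v n)\<close> fill the space, and
  \<open>l (v n) \<mapsto> l x\<close> is a well-defined map that commutes with all operators: a scalar \<open>d\<close>.  Then
  every \<open>l\<close> kills \<open>x - (v n) d\<close>, and the induction hypothesis applies to this vector.
\<close>

lemma in_span_if_annihilated:
  fixes n :: nat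
  assumes "\<And>i. i < n \<Longrightarrow> v i \<in> carrier V" "x \<in> carrier V"
    and "\<And>t. \<lbrakk>t \<in> T; \<And>i. i < n \<Longrightarrow> t (v i) = \<zero>\<rbrakk> \<Longrightarrow> t x = \<zero>"
  shows "\<exists>c\<in>{..<n} \<rightarrow> carrier commutant. x = (\<Oplus>\<^bsub>space\<^esub>i\<in>{..<n}. c i \<odot>\<^bsub>space\<^esub> v i)"
  using assms
proof (induction n arbitrary: x)
  case 0
  have "x = \<zero>"
  proof (rule ccontr)
    assume "x \<noteq> \<zero>"
    then obtain t where "t \<in> T" "t x = x" using transitive[of x x] 0(2) by blast
    then show False using 0(3)[of t] \<open>x \<noteq> \<zero>\<close> by simp
  qed
  then show ?case using vs.V.finsum_empty by simp
next
  case (Suc n)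
  define L where "L = {t \<in> T. \<forall>i<n. t (v i) = \<zero>}"
  have vV: "v i \<in> carrier V" if "i \<le> n" for i using Suc.prems that by simp
  have LT: "l \<in> T" if "l \<in> L" for l using that by (simp add: L_def)
  have L_comp: "(\<lambda>v\<in>carrier V. t (l v)) \<in> L" if "t \<in> T" "l \<in> L" for t l
    using that vV T_comp[of t l] by (auto simp: L_def)
  have L_add: "(\<lambda>v\<in>carrier V. l v \<oplus> l' v) \<in> L" if "l \<in> L" "l' \<in> L" for l l'
    using that vV T_add[of l l'] by (auto simp: L_def)
  have L_minus: "(\<lambda>v\<in>carrier V. \<ominus> l v) \<in> L" if "l \<in> L" for l
    using that vV T_minus[of l] by (auto simp: L_def)
  have L_zero: "l x = \<zero>" if "l \<in> L" "l (v n) = \<zero>" for l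
    by (rule Suc.prems(3)[of l]) (use that in \<open>auto simp: L_def less_Suc_eq\<close>)
  have span_Suc: ?case if d: "d \<in> carrier commutant"
    and y: "\<And>l. l \<in> L \<Longrightarrow> l (x \<ominus> d (v n)) = \<zero>" for d
  proof -
    have dv: "d (v n) \<in> carrier V" using d vV by simp
    obtain c where c: "c \<in> {..<n} \<rightarrow> carrier commutant"
      "x \<ominus> d (v n) = (\<Oplus>\<^bsub>space\<^esub>i\<in>{..<n}. c i \<odot>\<^bsub>space\<^esub> v i)"
      using Suc.IH[of "x \<ominus> d (v n)"] vV Suc.prems(2) y dv unfolding L_def by force
    have cv: "c i (v i) \<in> carrier V" if "i < n" for i
      by (rule commutant_closed) (use c(1) vV[of i] that in auto)
    let ?c = "c(n := d)"
    have "(\<Oplus>\<^bsub>space\<^esub>i\<in>{..<Suc n}. ?c i \<odot>\<^bsub>space\<^esub> v i)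
        = ?c n \<odot>\<^bsub>space\<^esub> v n \<oplus>\<^bsub>space\<^esub> (\<Oplus>\<^bsub>space\<^esub>i\<in>{..<n}. ?c i \<odot>\<^bsub>space\<^esub> v i)"
      unfolding lessThan_Suc by (rule vs.V.finsum_insert) (simp_all add: cv dv Pi_iff)
    also have "(\<Oplus>\<^bsub>space\<^esub>i\<in>{..<n}. ?c i \<odot>\<^bsub>space\<^esub> v i) = x \<ominus> d (v n)"
      unfolding c(2) by (rule vs.V.finsum_cong') (simp_all add: cv Pi_iff)
    finally have "(\<Oplus>\<^bsub>space\<^esub>i\<in>{..<Suc n}. ?c i \<odot>\<^bsub>space\<^esub> v i) = x"
      using dv Suc.prems(2) by (simp add: minus_eq a_lcomm r_neg)
    moreover have "?c \<in> {..<Suc n} \<rightarrow> carrier commutant" using c(1) d by (simp add: Pi_iff)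
    ultimately show ?thesis by (rule bexI[where x = ?c, OF sym])
  qed
  show ?case
  proof (cases "\<forall>l\<in>L. l (v n) = \<zero>")
    case True
    show ?thesis
    proof (rule span_Suc[OF vs.D.zero_closed])
      fix l assume "l \<in> L"
      then have "l x = \<zero>" using True L_zero[of l] by blast
      moreover have "x \<ominus> \<zero>\<^bsub>commutant\<^esub> (v n) = x"
        using vV[of n] Suc.prems(2) minus_equality[of "\<zero>" "\<zero>"] by (simp add: minus_eq)
      ultimately show "l (x \<ominus> \<zero>\<^bsub>commutant\<^esub> (v n)) = \<zero>" by simp
    qed
  next
    case False
    then obtain l0 where l0: "l0 \<in> L" "l0 (v n) \<noteq> \<zero>" by blast
    have surj: "\<exists>l\<in>L. l (v n) = y" if y: "y \<in> carrier V" for y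
    proof -
      obtain t where "t \<in> T" "t (l0 (v n)) = y"
        using transitive[of "l0 (v n)" y] y l0 LT vV by auto
      then show ?thesis using L_comp[OF _ l0(1), of t] vV by (intro bexI) auto
    qed
    have wd: "l x = l' x" if l: "l \<in> L" "l' \<in> L" "l (v n) = l' (v n)" for l l'
    proof -
      let ?k = "\<lambda>v\<in>carrier V. l v \<oplus> (\<lambda>v\<in>carrier V. \<ominus> l' v) v"
      have "?k x = \<zero>"
      proof (rule L_zero)
        show "?k \<in> L" using l by (intro L_add L_minus)
        show "?k (v n) = \<zero>" using l(3) LT[OF l(2)] vV[of n] by (simp add: r_neg)
      qed
      then have "l x \<ominus> l' x = \<zero>" using Suc.prems(2) by (simp add: minus_eq)
      then show ?thesis
        using LT[OF l(1)] LT[OF l(2)] minus_zeroD[of "l x" "l' x"] Suc.prems(2) by simp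
    qed
    define d where "d = (\<lambda>y\<in>carrier V. (SOME l. l \<in> L \<and> l (v n) = y) x)"
    have d: "d (l (v n)) = l x" if l: "l \<in> L" for l
    proof -
      have "\<exists>l'. l' \<in> L \<and> l' (v n) = l (v n)" using l by blast
      from someI_ex[OF this] show ?thesis
        using wd[of "SOME l'. l' \<in> L \<and> l' (v n) = l (v n)" l] l LT[OF l] vV[of n]
        unfolding d_def by simp
    qed
    have "d \<in> carrier commutant"
      unfolding commutant_iff
    proof (intro conjI ballI)
      show "d \<in> carrier V \<rightarrow>\<^sub>E carrier V"
      proof (rule PiE_I)
        fix y assume "y \<in> carrier V"
        then obtain l where "l \<in> L" "l (v n) = y" using surj by blast
        then show "d y \<in> carrier V" using d[of l] LT[of l] Suc.prems(2) by auto
      qed (simp add: d_def)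
    next
      fix y z assume "y \<in> carrier V" "z \<in> carrier V"
      then obtain l l' where "l \<in> L" "l (v n) = y" "l' \<in> L" "l' (v n) = z"
        using surj by metis
      then show "d (y \<oplus> z) = d y \<oplus> d z"
        using d[of l] d[of l'] d[OF L_add[of l l']] vV[of n] Suc.prems(2) by auto
    next
      fix t y assume "t \<in> T" "y \<in> carrier V"
      then obtain l where "l \<in> L" "l (v n) = y" using surj by metis
      then show "d (t y) = t (d y)"
        using d[of l] d[OF L_comp[of t l]] \<open>t \<in> T\<close> vV[of n] Suc.prems(2) by auto
    qed
    then show ?thesis
    proof (rule span_Suc)
      fix l assume l: "l \<in> L"
      have dv: "d (v n) \<in> carrier V" using \<open>d \<in> carrier commutant\<close> vV by simp
      have "l (d (v n)) = l x"
        using commutant_commutes[OF \<open>d \<in> carrier commutant\<close> LT[OF l], of "v n"] vV d[OF l] by simp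
      then show "l (x \<ominus> d (v n)) = \<zero>"
        using LT[OF l] Suc.prems(2) dv by (simp add: minus_eq T_additive T_uminus r_neg)
    qed
  qed
qed

lemma lin_independent_not_in_span:
  assumes li: "lin_independent commutant space n v" and m: "m < n"
    and c: "c \<in> {..<m} \<rightarrow> carrier commutant"
  shows "v m \<noteq> (\<Oplus>\<^bsub>space\<^esub>i\<in>{..<m}. c i \<odot>\<^bsub>space\<^esub> v i)"
proof
  assume eq: "v m = (\<Oplus>\<^bsub>space\<^esub>i\<in>{..<m}. c i \<odot>\<^bsub>space\<^esub> v i)"
  have vV: "v i \<in> carrier V" if "i < n" for i
    using li that by (auto simp: lin_independent_def)
  (* Moving v m to the right-hand side gives a linear relation among all n vectors, in which the
     vectors after v m have the coefficient zero. *)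
  define e where "e = \<ominus>\<^bsub>commutant\<^esub> \<one>\<^bsub>commutant\<^esub>"
  define b where "b i = (if i < m then c i else if i = m then e else \<zero>\<^bsub>commutant\<^esub>)" for i
  have e: "e \<in> carrier commutant" unfolding e_def by (intro vs.D.a_inv_closed vs.D.one_closed)
  have b: "b i \<in> carrier commutant" for i
    using c e vs.D.zero_closed by (auto simp: b_def simp del: commutant_ops)
  have "(\<Oplus>\<^bsub>space\<^esub>i\<in>{..<n}. b i \<odot>\<^bsub>space\<^esub> v i) = (\<Oplus>\<^bsub>space\<^esub>i\<in>{..<Suc m}. b i \<odot>\<^bsub>space\<^esub> v i)"
    by (rule vs.V.add.finprod_mono_neutral_cong_left[symmetric])
      (use m b vV in \<open>auto simp: b_def\<close>)
  also have "\<dots> = b m \<odot>\<^bsub>space\<^esub> v m \<oplus>\<^bsub>space\<^esub> (\<Oplus>\<^bsub>space\<^esub>i\<in>{..<m}. b i \<odot>\<^bsub>space\<^esub> v i)"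
    unfolding lessThan_Suc by (rule vs.V.finsum_insert) (use b vV m in auto)
  also have "(\<Oplus>\<^bsub>space\<^esub>i\<in>{..<m}. b i \<odot>\<^bsub>space\<^esub> v i) = v m"
    unfolding eq by (rule vs.V.finsum_cong') (use b c vV m in \<open>auto simp: b_def Pi_iff\<close>)
  also have "b m \<odot>\<^bsub>space\<^esub> v m \<oplus>\<^bsub>space\<^esub> v m = (e \<oplus>\<^bsub>commutant\<^esub> \<one>\<^bsub>commutant\<^esub>) \<odot>\<^bsub>space\<^esub> v m"
    using e vV[OF m] by (simp add: b_def)
  also have "e \<oplus>\<^bsub>commutant\<^esub> \<one>\<^bsub>commutant\<^esub> = \<zero>\<^bsub>commutant\<^esub>"
    unfolding e_def by (intro vs.D.l_neg vs.D.one_closed)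
  finally have "(\<Oplus>\<^bsub>space\<^esub>i\<in>{..<n}. b i \<odot>\<^bsub>space\<^esub> v i) = \<zero>\<^bsub>space\<^esub>"
    using vV[OF m] by simp
  then have "b m = \<zero>\<^bsub>commutant\<^esub>" using li m b unfolding lin_independent_def by blast
  then have "e = \<zero>\<^bsub>commutant\<^esub>" by (simp add: b_def)
  then have "\<one>\<^bsub>commutant\<^esub> = \<zero>\<^bsub>commutant\<^esub>"
    unfolding e_def using vs.D.one_closed by (metis vs.D.minus_minus vs.D.minus_zero)
  then show False using obtain_nonzero by (metis commutant_ops(1,2) restrict_apply')
qed

text \<open>
  The images of independent vectors are prescribed one at a time.  Since \<open>v m\<close> is not in the span of
  the earlier vectors, some operator \<open>l\<close> kills those but not \<open>v m\<close>; following it by an operator that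
  takes \<open>l (v m)\<close> to the remaining error at \<open>v m\<close> gives a correction that leaves the earlier vectors
  untouched.
\<close>

theorem density: "dense_subring commutant space T"
proof -
  interpret E: ring "End_ring commutant space" by (rule vs.ring_End_ring)
  have TE: "T \<subseteq> carrier (End_ring commutant space)"
    using T_maps by (auto simp: End_ring_def T_additive commutant_commutes)
  obtain v where v: "v \<in> carrier V" "v \<noteq> \<zero>" by (rule obtain_nonzero)
  have "subgroup T (add_monoid (End_ring commutant space))"
  proof (rule group.subgroupI[OF E.a_group])
    show "T \<noteq> {}" using transitive[OF v v(1)] by blast
    fix s t assume st: "s \<in> T" "t \<in> T"
    then show "s \<otimes>\<^bsub>add_monoid (End_ring commutant space)\<^esub> t \<in> T"
      using T_add by (simp add: End_ring_def)
    have "\<ominus>\<^bsub>End_ring commutant space\<^esub> s = (\<lambda>v\<in>carrier V. \<ominus> s v)"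
    proof (rule E.minus_equality)
      show "(\<lambda>v\<in>carrier V. \<ominus> s v) \<oplus>\<^bsub>End_ring commutant space\<^esub> s = \<zero>\<^bsub>End_ring commutant space\<^esub>"
        using st(1) by (auto simp: End_ring_def l_neg fun_eq_iff)
    qed (use TE T_minus st in auto)
    then show "inv\<^bsub>add_monoid (End_ring commutant space)\<^esub> s \<in> T"
      using T_minus[OF st(1)] by (simp add: a_inv_def)
  qed (use TE in simp)
  moreover have "s \<otimes>\<^bsub>End_ring commutant space\<^esub> t \<in> T" if "s \<in> T" "t \<in> T" for s t
    using T_comp[OF that] by (simp add: End_ring_def)
  moreover have "\<exists>t\<in>T. \<forall>i<n. t (v i) = w i"
    if li: "lin_independent commutant space n v" and w: "w \<in> {..<n} \<rightarrow> carrier space" for n v w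
  proof -
    have vV: "v i \<in> carrier V" if "i < n" for i
      using li that by (auto simp: lin_independent_def)
    have wV: "w i \<in> carrier V" if "i < n" for i using w that by auto
    have "\<exists>t\<in>T. \<forall>i<m. t (v i) = w i" if "m \<le> n" for m
      using that
    proof (induction m)
      case 0
      then show ?case using transitive[OF v v(1)] by auto
    next
      case (Suc m)
      then obtain t where t: "t \<in> T" "\<And>i. i < m \<Longrightarrow> t (v i) = w i" by auto
      have m: "m < n" using Suc.prems by simp
      have "\<exists>l\<in>T. (\<forall>i<m. l (v i) = \<zero>) \<and> l (v m) \<noteq> \<zero>"
      proof (rule ccontr)
        assume *: "\<not> ?thesis"
        have "\<exists>c\<in>{..<m} \<rightarrow> carrier commutant. v m = (\<Oplus>\<^bsub>space\<^esub>i\<in>{..<m}. c i \<odot>\<^bsub>space\<^esub> v i)"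
        proof (rule in_span_if_annihilated)
          fix t assume "t \<in> T" "\<And>i. i < m \<Longrightarrow> t (v i) = \<zero>"
          then show "t (v m) = \<zero>" using * by blast
        qed (use vV m in auto)
        then show False using lin_independent_not_in_span[OF li m] by blast
      qed
      then obtain l where l: "l \<in> T" "\<And>i. i < m \<Longrightarrow> l (v i) = \<zero>" "l (v m) \<noteq> \<zero>" by blast
      obtain s where s: "s \<in> T" "s (l (v m)) = w m \<ominus> t (v m)"
        using transitive[of "l (v m)" "w m \<ominus> t (v m)"] l(1,3) vV[OF m] wV[OF m] t(1) by auto
      let ?r = "\<lambda>u\<in>carrier V. t u \<oplus> (\<lambda>u\<in>carrier V. s (l u)) u"
      have "?r \<in> T" using t(1) s(1) l(1) by (intro T_add T_comp)
      moreover have "?r (v i) = w i" if "i < Suc m" for i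
      proof (cases "i = m")
        case True
        then show ?thesis
          using s t(1) vV[OF m] wV[OF m] by (simp add: minus_eq a_lcomm r_neg)
      next
        case False
        then show ?thesis using that t(2)[of i] l(2)[of i] t(1) s(1) vV[of i] wV[of i] m by simp
      qed
      ultimately show ?case by blast
    qed
    then show ?thesis by blast
  qed
  ultimately show ?thesis unfolding dense_subring_def by blast
qed

end


section \<open>Differences of an irreducible semimodule\<close>

text \<open>
  With the zero multiplication every commutative monoid is a hemiring, and its ring of differences
  is, as an additive group, the group of differences of the monoid.  In this way the construction of
  \<open>diff_ring\<close> also serves for semimodules.
\<close>

definition null_ring :: "('m, 'c) ring_scheme \<Rightarrow> 'm ring" where
  "null_ring M =
    \<lparr>carrier = carrier M, mult = (\<lambda>_ _. \<zero>\<^bsub>M\<^esub>), one = undefined, zero = \<zero>\<^bsub>M\<^esub>, add = add M\<rparr>"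

lemma null_ring_simps [simp]:
  "carrier (null_ring M) = carrier M" "\<zero>\<^bsub>null_ring M\<^esub> = \<zero>\<^bsub>M\<^esub>"
  "x \<oplus>\<^bsub>null_ring M\<^esub> y = x \<oplus>\<^bsub>M\<^esub> y" "x \<otimes>\<^bsub>null_ring M\<^esub> y = \<zero>\<^bsub>M\<^esub>"
  by (simp_all add: null_ring_def)

lemma (in abelian_monoid) hemiring_null_ring: "hemiring (null_ring G)"
  by (intro hemiring.intro abelian_monoidI hemiring_axioms.intro) (auto simp: a_ac)

text \<open>
  Separation is stronger than faithfulness, since over a hemiring the equation \<open>a m = b m\<close> cannot be
  rewritten as \<open>(a - b) m = 0\<close>.  It is what makes the ring of differences act faithfully.
\<close>

locale separated_irreducible = left_semimodule R M for R (structure) and M (structure) +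
  assumes irreducible: "irreducible_semimodule R M"
    and separated: "\<lbrakk>a \<in> carrier R; b \<in> carrier R; \<And>m. m \<in> carrier M \<Longrightarrow> a \<odot>\<^bsub>M\<^esub> m = b \<odot>\<^bsub>M\<^esub> m\<rbrakk> \<Longrightarrow> a = b"
begin

lemmas semimodule_simps = m_closed smult_closed smult_assoc smult_r_distr smult_l_distr
  smult_r_null smult_l_null

lemma cancel:
  assumes "x \<oplus>\<^bsub>M\<^esub> z = y \<oplus>\<^bsub>M\<^esub> z" "x \<in> carrier M" "y \<in> carrier M" "z \<in> carrier M"
  shows "x = y"
  using irreducible assms unfolding irreducible_semimodule_def add_cancellative_def by blast

lemma add_cancellative_R: "add_cancellative R"
  unfolding add_cancellative_def
proof (intro ballI impI)
  fix a b c assume c: "a \<in> carrier R" "b \<in> carrier R" "c \<in> carrier R" "a \<oplus> c = b \<oplus> c"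
  have "a \<odot>\<^bsub>M\<^esub> m = b \<odot>\<^bsub>M\<^esub> m" if "m \<in> carrier M" for m
  proof (rule cancel)
    show "a \<odot>\<^bsub>M\<^esub> m \<oplus>\<^bsub>M\<^esub> c \<odot>\<^bsub>M\<^esub> m = b \<odot>\<^bsub>M\<^esub> m \<oplus>\<^bsub>M\<^esub> c \<odot>\<^bsub>M\<^esub> m"
      using c that by (simp flip: smult_l_distr)
  qed (use c that in \<open>auto simp: smult_closed\<close>)
  then show "a = b" using c separated by blast
qed

abbreviation G where "G \<equiv> diff_ring (null_ring M)"

abbreviation cls where "cls p q \<equiv> diff_class (null_ring M) p q"

text \<open>
  The element \<open>a - b\<close> of the ring of differences acts on \<open>x = p - q\<close>; the choice of the pair \<open>(p, q)\<close>
  is immaterial by \<open>act_cls\<close>.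
\<close>

definition act where
  "act a b = (\<lambda>x\<in>carrier G.
    let pq = (SOME pq. pq \<in> carrier M \<times> carrier M \<and> x = cls (fst pq) (snd pq)) in
    cls (a \<odot>\<^bsub>M\<^esub> fst pq \<oplus>\<^bsub>M\<^esub> b \<odot>\<^bsub>M\<^esub> snd pq) (a \<odot>\<^bsub>M\<^esub> snd pq \<oplus>\<^bsub>M\<^esub> b \<odot>\<^bsub>M\<^esub> fst pq))"

lemma cls_closed [simp]: "\<lbrakk>p \<in> carrier M; q \<in> carrier M\<rbrakk> \<Longrightarrow> cls p q \<in> carrier G"
  and cls_add: "\<lbrakk>p \<in> carrier M; q \<in> carrier M; p' \<in> carrier M; q' \<in> carrier M\<rbrakk> \<Longrightarrow>
    cls p q \<oplus>\<^bsub>G\<^esub> cls p' q' = cls (p \<oplus>\<^bsub>M\<^esub> p') (q \<oplus>\<^bsub>M\<^esub> q')"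
  and cls_zero: "\<zero>\<^bsub>G\<^esub> = cls \<zero>\<^bsub>M\<^esub> \<zero>\<^bsub>M\<^esub>"
  and cls_eq_iff: "\<lbrakk>p \<in> carrier M; q \<in> carrier M; p' \<in> carrier M; q' \<in> carrier M\<rbrakk> \<Longrightarrow>
    cls p q = cls p' q' \<longleftrightarrow> p \<oplus>\<^bsub>M\<^esub> q' = p' \<oplus>\<^bsub>M\<^esub> q"
  and cls_cases: "x \<in> carrier G \<Longrightarrow> \<exists>p\<in>carrier M. \<exists>q\<in>carrier M. x = cls p q"
  and abelian_group_G: "abelian_group G"
proof -
  interpret N: hemiring "null_ring M" by (rule M.hemiring_null_ring)
  have "add_cancellative (null_ring M)"
    using irreducible unfolding irreducible_semimodule_def add_cancellative_def by simp
  then show "\<lbrakk>p \<in> carrier M; q \<in> carrier M; p' \<in> carrier M; q' \<in> carrier M\<rbrakk> \<Longrightarrow>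
      cls p q = cls p' q' \<longleftrightarrow> p \<oplus>\<^bsub>M\<^esub> q' = p' \<oplus>\<^bsub>M\<^esub> q"
    using N.diff_class_eq_iff_cancel[of p q p' q'] by simp
  show "x \<in> carrier G \<Longrightarrow> \<exists>p\<in>carrier M. \<exists>q\<in>carrier M. x = cls p q"
    by (erule N.diff_ring_cases) auto
  show "\<lbrakk>p \<in> carrier M; q \<in> carrier M\<rbrakk> \<Longrightarrow> cls p q \<in> carrier G"
    using N.diff_class_carrier[of p q] by simp
  show "\<lbrakk>p \<in> carrier M; q \<in> carrier M; p' \<in> carrier M; q' \<in> carrier M\<rbrakk> \<Longrightarrow>
      cls p q \<oplus>\<^bsub>G\<^esub> cls p' q' = cls (p \<oplus>\<^bsub>M\<^esub> p') (q \<oplus>\<^bsub>M\<^esub> q')"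
    using N.diff_ring_add[of p q p' q'] by simp
  show "\<zero>\<^bsub>G\<^esub> = cls \<zero>\<^bsub>M\<^esub> \<zero>\<^bsub>M\<^esub>" using N.diff_ring_zero by simp
  show "abelian_group G" by (rule N.diff_ring_abelian_group)
qed

lemma act_cls:
  assumes a: "a \<in> carrier R" "b \<in> carrier R" and p: "p \<in> carrier M" "q \<in> carrier M"
  shows "act a b (cls p q) = cls (a \<odot>\<^bsub>M\<^esub> p \<oplus>\<^bsub>M\<^esub> b \<odot>\<^bsub>M\<^esub> q) (a \<odot>\<^bsub>M\<^esub> q \<oplus>\<^bsub>M\<^esub> b \<odot>\<^bsub>M\<^esub> p)"
proof -
  define s where "s = (SOME s. s \<in> carrier M \<times> carrier M \<and> cls p q = cls (fst s) (snd s))"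
  have "\<exists>s. s \<in> carrier M \<times> carrier M \<and> cls p q = cls (fst s) (snd s)"
    using p by (intro exI[of _ "(p, q)"]) auto
  from someI_ex[OF this] have s: "s \<in> carrier M \<times> carrier M" "cls p q = cls (fst s) (snd s)"
    unfolding s_def by blast+
  obtain p' q' where s': "s = (p', q')" by (cases s)
  then have p': "p' \<in> carrier M" "q' \<in> carrier M" "p \<oplus>\<^bsub>M\<^esub> q' = p' \<oplus>\<^bsub>M\<^esub> q"
    using s p by (auto simp: cls_eq_iff)
  have "(a \<odot>\<^bsub>M\<^esub> p' \<oplus>\<^bsub>M\<^esub> b \<odot>\<^bsub>M\<^esub> q') \<oplus>\<^bsub>M\<^esub> (a \<odot>\<^bsub>M\<^esub> q \<oplus>\<^bsub>M\<^esub> b \<odot>\<^bsub>M\<^esub> p)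
      = a \<odot>\<^bsub>M\<^esub> (p' \<oplus>\<^bsub>M\<^esub> q) \<oplus>\<^bsub>M\<^esub> b \<odot>\<^bsub>M\<^esub> (p \<oplus>\<^bsub>M\<^esub> q')"
    using a p p'(1,2) by (simp add: semimodule_simps M.a_ac)
  also have "\<dots> = a \<odot>\<^bsub>M\<^esub> (p \<oplus>\<^bsub>M\<^esub> q') \<oplus>\<^bsub>M\<^esub> b \<odot>\<^bsub>M\<^esub> (p' \<oplus>\<^bsub>M\<^esub> q)" using p' by simp
  also have "\<dots> = (a \<odot>\<^bsub>M\<^esub> p \<oplus>\<^bsub>M\<^esub> b \<odot>\<^bsub>M\<^esub> q) \<oplus>\<^bsub>M\<^esub> (a \<odot>\<^bsub>M\<^esub> q' \<oplus>\<^bsub>M\<^esub> b \<odot>\<^bsub>M\<^esub> p')"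
    using a p p'(1,2) by (simp add: semimodule_simps M.a_ac)
  finally show ?thesis
    using a p p' unfolding act_def
    by (simp add: s_def[symmetric] s' cls_eq_iff semimodule_simps)
qed

lemma act_extensional: "x \<notin> carrier G \<Longrightarrow> act a b x = undefined"
  by (simp add: act_def)

lemma act_eqI:
  assumes "a \<in> carrier R" "b \<in> carrier R"
    and "\<And>x. x \<notin> carrier G \<Longrightarrow> f x = undefined"
    and "\<And>p q. \<lbrakk>p \<in> carrier M; q \<in> carrier M\<rbrakk> \<Longrightarrow>
      f (cls p q) = cls (a \<odot>\<^bsub>M\<^esub> p \<oplus>\<^bsub>M\<^esub> b \<odot>\<^bsub>M\<^esub> q) (a \<odot>\<^bsub>M\<^esub> q \<oplus>\<^bsub>M\<^esub> b \<odot>\<^bsub>M\<^esub> p)"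
  shows "f = act a b"
proof
  fix x show "f x = act a b x"
  proof (cases "x \<in> carrier G")
    case True
    then obtain p q where "p \<in> carrier M" "q \<in> carrier M" "x = cls p q" using cls_cases by blast
    then show ?thesis using assms act_cls by simp
  qed (use assms act_extensional in simp)
qed

text \<open>
  The right-hand side is equality of \<open>a - b\<close> and \<open>c - d\<close> in the ring of differences.  So the action
  is well defined on this ring, by one direction, and faithful, by the other; the latter
  follows from the values at the differences \<open>m - 0\<close> and separation.
\<close>

lemma act_eq_iff:
  assumes c: "a \<in> carrier R" "b \<in> carrier R" "c \<in> carrier R" "d \<in> carrier R"
  shows "act a b = act c d \<longleftrightarrow> a \<oplus> d = c \<oplus> b"
proof
  assume eq: "act a b = act c d"
  have "(a \<oplus> d) \<odot>\<^bsub>M\<^esub> m = (c \<oplus> b) \<odot>\<^bsub>M\<^esub> m" if m: "m \<in> carrier M" for m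
    using fun_cong[OF eq, of "cls m \<zero>\<^bsub>M\<^esub>"] c m by (simp add: act_cls cls_eq_iff semimodule_simps)
  then show "a \<oplus> d = c \<oplus> b" using c by (intro separated) auto
next
  assume eq: "a \<oplus> d = c \<oplus> b"
  show "act a b = act c d"
  proof (rule act_eqI)
    fix p q assume pq: "p \<in> carrier M" "q \<in> carrier M"
    have "(a \<odot>\<^bsub>M\<^esub> p \<oplus>\<^bsub>M\<^esub> b \<odot>\<^bsub>M\<^esub> q) \<oplus>\<^bsub>M\<^esub> (c \<odot>\<^bsub>M\<^esub> q \<oplus>\<^bsub>M\<^esub> d \<odot>\<^bsub>M\<^esub> p)
        = (a \<oplus> d) \<odot>\<^bsub>M\<^esub> p \<oplus>\<^bsub>M\<^esub> (c \<oplus> b) \<odot>\<^bsub>M\<^esub> q"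
      using c pq by (simp add: semimodule_simps M.a_ac)
    also have "\<dots> = (c \<oplus> b) \<odot>\<^bsub>M\<^esub> p \<oplus>\<^bsub>M\<^esub> (a \<oplus> d) \<odot>\<^bsub>M\<^esub> q" unfolding eq ..
    also have "\<dots> = (c \<odot>\<^bsub>M\<^esub> p \<oplus>\<^bsub>M\<^esub> d \<odot>\<^bsub>M\<^esub> q) \<oplus>\<^bsub>M\<^esub> (a \<odot>\<^bsub>M\<^esub> q \<oplus>\<^bsub>M\<^esub> b \<odot>\<^bsub>M\<^esub> p)"
      using c pq by (simp add: semimodule_simps M.a_ac)
    finally show "act a b (cls p q) = cls (c \<odot>\<^bsub>M\<^esub> p \<oplus>\<^bsub>M\<^esub> d \<odot>\<^bsub>M\<^esub> q) (c \<odot>\<^bsub>M\<^esub> q \<oplus>\<^bsub>M\<^esub> d \<odot>\<^bsub>M\<^esub> p)"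
      using c pq by (simp add: act_cls cls_eq_iff semimodule_simps)
  qed (use c act_extensional in auto)
qed

lemma act_plus:
  assumes "a \<in> carrier R" "b \<in> carrier R" "c \<in> carrier R" "d \<in> carrier R"
  shows "(\<lambda>x\<in>carrier G. act a b x \<oplus>\<^bsub>G\<^esub> act c d x) = act (a \<oplus> c) (b \<oplus> d)"
  by (rule act_eqI) (use assms in \<open>auto simp: act_cls cls_add semimodule_simps M.a_ac\<close>)

lemma act_comp:
  assumes "a \<in> carrier R" "b \<in> carrier R" "c \<in> carrier R" "d \<in> carrier R"
  shows "(\<lambda>x\<in>carrier G. act a b (act c d x)) = act (a \<otimes> c \<oplus> b \<otimes> d) (a \<otimes> d \<oplus> b \<otimes> c)"
  by (rule act_eqI) (use assms in \<open>auto simp: act_cls semimodule_simps M.a_ac\<close>)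

lemma act_minus:
  assumes "a \<in> carrier R" "b \<in> carrier R"
  shows "(\<lambda>x\<in>carrier G. \<ominus>\<^bsub>G\<^esub> act a b x) = act b a"
proof (rule act_eqI)
  interpret G: abelian_group G by (rule abelian_group_G)
  have "\<ominus>\<^bsub>G\<^esub> cls p q = cls q p" if "p \<in> carrier M" "q \<in> carrier M" for p q
    by (rule G.minus_equality) (use that in \<open>auto simp: cls_add cls_zero cls_eq_iff M.a_ac\<close>)
  then show "(\<lambda>x\<in>carrier G. \<ominus>\<^bsub>G\<^esub> act a b x) (cls p q)
      = cls (b \<odot>\<^bsub>M\<^esub> p \<oplus>\<^bsub>M\<^esub> a \<odot>\<^bsub>M\<^esub> q) (b \<odot>\<^bsub>M\<^esub> q \<oplus>\<^bsub>M\<^esub> a \<odot>\<^bsub>M\<^esub> p)"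
    if "p \<in> carrier M" "q \<in> carrier M" for p q
    using assms that by (simp add: act_cls semimodule_simps M.a_ac)
qed (use assms in auto)

text \<open>
  For \<open>x = m - n\<close> and \<open>y = p - q\<close>, irreducibility gives \<open>p = (r\<^sub>2 - r\<^sub>1) x\<close> and \<open>q = (s\<^sub>2 - s\<^sub>1) x\<close> in the
  group of differences, whence \<open>y = ((r\<^sub>2 + s\<^sub>1) - (r\<^sub>1 + s\<^sub>2)) x\<close>.
\<close>

lemma act_transitive:
  assumes x: "x \<in> carrier G" "x \<noteq> \<zero>\<^bsub>G\<^esub>" and y: "y \<in> carrier G"
  shows "\<exists>a\<in>carrier R. \<exists>b\<in>carrier R. act a b x = y"
proof -
  obtain m n where m: "m \<in> carrier M" "n \<in> carrier M" "x = cls m n" using cls_cases x by blast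
  obtain p q where p: "p \<in> carrier M" "q \<in> carrier M" "y = cls p q" using cls_cases y by blast
  have "m \<noteq> n" using x(2) m by (auto simp: cls_zero cls_eq_iff)
  then obtain r1 r2 s1 s2 where
    r: "r1 \<in> carrier R" "r2 \<in> carrier R"
      "p \<oplus>\<^bsub>M\<^esub> r1 \<odot>\<^bsub>M\<^esub> m \<oplus>\<^bsub>M\<^esub> r2 \<odot>\<^bsub>M\<^esub> n = r1 \<odot>\<^bsub>M\<^esub> n \<oplus>\<^bsub>M\<^esub> r2 \<odot>\<^bsub>M\<^esub> m" and
    s: "s1 \<in> carrier R" "s2 \<in> carrier R"
      "q \<oplus>\<^bsub>M\<^esub> s1 \<odot>\<^bsub>M\<^esub> m \<oplus>\<^bsub>M\<^esub> s2 \<odot>\<^bsub>M\<^esub> n = s1 \<odot>\<^bsub>M\<^esub> n \<oplus>\<^bsub>M\<^esub> s2 \<odot>\<^bsub>M\<^esub> m"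
    using irreducible m p unfolding irreducible_semimodule_def by metis
  note c = m(1,2) p(1,2) r(1,2) s(1,2)
  have "act (r2 \<oplus> s1) (r1 \<oplus> s2) x = y"
  proof -
    have "((r2 \<oplus> s1) \<odot>\<^bsub>M\<^esub> m \<oplus>\<^bsub>M\<^esub> (r1 \<oplus> s2) \<odot>\<^bsub>M\<^esub> n) \<oplus>\<^bsub>M\<^esub> q
        = (r1 \<odot>\<^bsub>M\<^esub> n \<oplus>\<^bsub>M\<^esub> r2 \<odot>\<^bsub>M\<^esub> m) \<oplus>\<^bsub>M\<^esub> (q \<oplus>\<^bsub>M\<^esub> s1 \<odot>\<^bsub>M\<^esub> m \<oplus>\<^bsub>M\<^esub> s2 \<odot>\<^bsub>M\<^esub> n)"
      using c by (simp add: semimodule_simps M.a_ac)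
    also have "\<dots> = (p \<oplus>\<^bsub>M\<^esub> r1 \<odot>\<^bsub>M\<^esub> m \<oplus>\<^bsub>M\<^esub> r2 \<odot>\<^bsub>M\<^esub> n) \<oplus>\<^bsub>M\<^esub> (s1 \<odot>\<^bsub>M\<^esub> n \<oplus>\<^bsub>M\<^esub> s2 \<odot>\<^bsub>M\<^esub> m)"
      using r(3) s(3) by simp
    also have "\<dots> = p \<oplus>\<^bsub>M\<^esub> ((r2 \<oplus> s1) \<odot>\<^bsub>M\<^esub> n \<oplus>\<^bsub>M\<^esub> (r1 \<oplus> s2) \<odot>\<^bsub>M\<^esub> m)"
      using c by (simp add: semimodule_simps M.a_ac)
    finally show ?thesis
      using c unfolding m(3) p(3) by (simp add: act_cls cls_eq_iff smult_closed)
  qed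
  then show ?thesis using c by blast
qed

definition difference_operators where
  "difference_operators = (\<lambda>(a, b). act a b) ` (carrier R \<times> carrier R)"

lemma difference_operators_irreducible: "irreducible_operators G difference_operators"
proof -
  interpret G: abelian_group G by (rule abelian_group_G)
  have act_closed: "act a b x \<in> carrier G" if "a \<in> carrier R" "b \<in> carrier R" "x \<in> carrier G" for a b x
    using cls_cases[OF that(3)] that by (auto simp: act_cls smult_closed)
  obtain m where m: "m \<in> carrier M" "m \<noteq> \<zero>\<^bsub>M\<^esub>"
    using irreducible M.zero_closed unfolding irreducible_semimodule_def by blast
  have "cls m \<zero>\<^bsub>M\<^esub> \<noteq> \<zero>\<^bsub>G\<^esub>" using m by (simp add: cls_zero cls_eq_iff)
  then have "carrier G \<noteq> {\<zero>\<^bsub>G\<^esub>}" using cls_closed[of m "\<zero>\<^bsub>M\<^esub>"] m by auto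
  then show ?thesis
  proof (unfold_locales, goal_cases)
    case (2 t)
    then show ?case
      by (auto simp: difference_operators_def act_closed act_extensional intro!: PiE_I)
  next
    case (3 t v w)
    then show ?case
      using cls_cases[of v] cls_cases[of w]
      by (auto simp: difference_operators_def act_cls cls_add semimodule_simps M.a_ac)
  next
    case (4 s t)
    then show ?case
      unfolding difference_operators_def by (auto simp: act_plus image_iff intro!: bexI)
  next
    case (5 t)
    then show ?case
      unfolding difference_operators_def by (auto simp: act_minus image_iff intro!: bexI)
  next
    case (6 s t)
    then show ?case
      unfolding difference_operators_def by (auto simp: act_comp m_closed image_iff intro!: bexI)
  next
    case (7 x y)
    then show ?case
      using act_transitive[of x y] unfolding difference_operators_def by force
  qed
qed

theorem diff_ring_dense: "isomorphic_to_dense_subring (diff_ring R)"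
proof -
  interpret I: irreducible_operators G difference_operators
    by (rule difference_operators_irreducible)
  (* The image of X does not depend on the chosen representative, by act_eq_iff. *)
  define \<phi> where "\<phi> X = (let ab = (SOME ab. ab \<in> carrier R \<times> carrier R \<and>
    X = diff_class R (fst ab) (snd ab)) in act (fst ab) (snd ab))" for X
  have \<phi>: "\<phi> (diff_class R a b) = act a b" if ab: "a \<in> carrier R" "b \<in> carrier R" for a b
  proof -
    define s where "s = (SOME s. s \<in> carrier R \<times> carrier R \<and>
      diff_class R a b = diff_class R (fst s) (snd s))"
    have "\<exists>s. s \<in> carrier R \<times> carrier R \<and> diff_class R a b = diff_class R (fst s) (snd s)"
      using ab by (intro exI[of _ "(a, b)"]) auto
    from someI_ex[OF this]
    have s: "s \<in> carrier R \<times> carrier R" "diff_class R a b = diff_class R (fst s) (snd s)"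
      unfolding s_def by blast+
    then have "act a b = act (fst s) (snd s)"
      using ab by (auto simp: act_eq_iff diff_class_eq_iff_cancel[OF add_cancellative_R])
    then show ?thesis unfolding \<phi>_def s_def[symmetric] by simp
  qed
  have "hemiring_isomorphic (diff_ring R)
      (End_ring I.commutant I.space \<lparr>carrier := difference_operators\<rparr>)"
    unfolding hemiring_isomorphic_def
  proof (rule bexI[of _ \<phi>])
    show "bij_betw \<phi> (carrier (diff_ring R))
        (carrier (End_ring I.commutant I.space \<lparr>carrier := difference_operators\<rparr>))"
      unfolding bij_betw_def
    proof (intro conjI inj_onI)
      fix X Y assume X: "X \<in> carrier (diff_ring R)" and Y: "Y \<in> carrier (diff_ring R)"
        and eq: "\<phi> X = \<phi> Y"
      obtain a b where a: "a \<in> carrier R" "b \<in> carrier R" "X = diff_class R a b"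
        by (rule diff_ring_cases[OF X])
      obtain c d where c: "c \<in> carrier R" "d \<in> carrier R" "Y = diff_class R c d"
        by (rule diff_ring_cases[OF Y])
      have "a \<oplus> d = c \<oplus> b" using eq a c by (simp add: \<phi> act_eq_iff)
      then show "X = Y" using a c by (simp add: diff_class_eq_iff_cancel[OF add_cancellative_R])
    next
      show "\<phi> ` carrier (diff_ring R)
          = carrier (End_ring I.commutant I.space \<lparr>carrier := difference_operators\<rparr>)"
      proof (intro subset_antisym subsetI)
        fix t assume "t \<in> carrier (End_ring I.commutant I.space \<lparr>carrier := difference_operators\<rparr>)"
        then obtain a b where "a \<in> carrier R" "b \<in> carrier R" "t = act a b"
          by (auto simp: difference_operators_def)
        then show "t \<in> \<phi> ` carrier (diff_ring R)"
          using \<phi> diff_class_carrier by (intro image_eqI[of _ _ "diff_class R a b"]) auto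
      qed (auto elim!: diff_ring_cases simp: \<phi> difference_operators_def)
    qed
    have "\<phi> (X \<oplus>\<^bsub>diff_ring R\<^esub> Y) = (\<lambda>x\<in>carrier G. \<phi> X x \<oplus>\<^bsub>G\<^esub> \<phi> Y x)"
      "\<phi> (X \<otimes>\<^bsub>diff_ring R\<^esub> Y) = (\<lambda>x\<in>carrier G. \<phi> X (\<phi> Y x))"
      if "X \<in> carrier (diff_ring R)" "Y \<in> carrier (diff_ring R)" for X Y
      using that
      by (auto elim!: diff_ring_cases
          simp: \<phi> diff_ring_add diff_ring_mult act_plus act_comp m_closed)
    moreover have "\<phi> \<zero>\<^bsub>diff_ring R\<^esub> = (\<lambda>x\<in>carrier G. \<zero>\<^bsub>G\<^esub>)"
      unfolding diff_ring_zero \<phi>[OF R.zero_closed R.zero_closed]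
      by (rule act_eqI[symmetric]) (auto simp: cls_zero semimodule_simps)
    moreover have "\<phi> X \<in> difference_operators" if "X \<in> carrier (diff_ring R)" for X
      using that by (auto elim!: diff_ring_cases simp: \<phi> difference_operators_def)
    ultimately show "\<phi> \<in> hemiring_hom (diff_ring R)
        (End_ring I.commutant I.space \<lparr>carrier := difference_operators\<rparr>)"
      by (auto simp: hemiring_hom_def hom_def End_ring_def)
  qed
  then show ?thesis
    using I.nontrivial I.density I.space_vector_space
    by (intro isomorphic_to_dense_subringI[of I.commutant I.space]) auto
qed

end

section \<open>Primitive hemirings\<close>

text \<open>
  The maps \<open>m \<mapsto> r m\<close> are the quotient of \<open>R\<close> by the congruence that identifies elements with the same
  action on \<open>M\<close>.  Over this quotient \<open>M\<close> is separated.
\<close>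

definition operator_hemiring ::
    "('a, 'c) ring_scheme \<Rightarrow> ('a, 'm, 'd) module_scheme \<Rightarrow> ('m \<Rightarrow> 'm) ring" where
  "operator_hemiring R M =
    \<lparr>carrier = (\<lambda>r. \<lambda>m\<in>carrier M. r \<odot>\<^bsub>M\<^esub> m) ` carrier R,
     mult = (\<lambda>s t. \<lambda>m\<in>carrier M. s (t m)),
     one = undefined,
     zero = (\<lambda>m\<in>carrier M. \<zero>\<^bsub>M\<^esub>),
     add = (\<lambda>s t. \<lambda>m\<in>carrier M. s m \<oplus>\<^bsub>M\<^esub> t m)\<rparr>"

definition operator_semimodule :: "('a, 'm, 'd) module_scheme \<Rightarrow> ('m \<Rightarrow> 'm, 'm) module" where
  "operator_semimodule M =
    \<lparr>carrier = carrier M, mult = undefined, one = undefined, zero = \<zero>\<^bsub>M\<^esub>, add = add M,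
     smult = (\<lambda>s m. s m)\<rparr>"

lemma operator_semimodule_simps [simp]:
  "carrier (operator_semimodule M) = carrier M" "\<zero>\<^bsub>operator_semimodule M\<^esub> = \<zero>\<^bsub>M\<^esub>"
  "x \<oplus>\<^bsub>operator_semimodule M\<^esub> y = x \<oplus>\<^bsub>M\<^esub> y" "s \<odot>\<^bsub>operator_semimodule M\<^esub> x = s x"
  by (simp_all add: operator_semimodule_def)

context left_semimodule
begin

abbreviation op where "op r \<equiv> \<lambda>m\<in>carrier M. r \<odot>\<^bsub>M\<^esub> m"

lemma operator_hemiring_simps:
  "carrier (operator_hemiring R M) = op ` carrier R"
  "\<lbrakk>r \<in> carrier R; s \<in> carrier R\<rbrakk> \<Longrightarrow> op r \<oplus>\<^bsub>operator_hemiring R M\<^esub> op s = op (r \<oplus> s)"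
  "\<lbrakk>r \<in> carrier R; s \<in> carrier R\<rbrakk> \<Longrightarrow> op r \<otimes>\<^bsub>operator_hemiring R M\<^esub> op s = op (r \<otimes> s)"
  "\<zero>\<^bsub>operator_hemiring R M\<^esub> = op \<zero>"
  by (auto simp: operator_hemiring_def smult_l_distr smult_assoc smult_closed smult_l_null
      intro!: restrict_ext)

lemma hemiring_operator_hemiring: "hemiring (operator_hemiring R M)"
  by (intro hemiring.intro abelian_monoidI hemiring_axioms.intro)
    (auto simp: operator_hemiring_simps(1) operator_hemiring_simps(2-)[simplified] R.a_ac
      m_closed m_assoc l_distr r_distr l_null r_null)

lemma left_semimodule_operators:
  "left_semimodule (operator_hemiring R M) (operator_semimodule M)"
  by (intro left_semimodule.intro hemiring_operator_hemiring abelian_monoidI left_semimodule_axioms.intro)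
    (auto simp: M.a_ac operator_hemiring_def smult_closed smult_r_distr smult_r_null smult_assoc)

end

lemma operator_hemiring_dense:
  assumes irr: "irreducible_semimodule R M"
  shows "hemiring (operator_hemiring R M)" "add_cancellative (operator_hemiring R M)"
    "isomorphic_to_dense_subring (diff_ring (operator_hemiring R M))"
proof -
  interpret left_semimodule R M using irr by (simp add: irreducible_semimodule_def)
  have "irreducible_semimodule (operator_hemiring R M) (operator_semimodule M)"
    using irr left_semimodule_operators
    by (auto simp: irreducible_semimodule_def add_cancellative_def operator_hemiring_simps(1))
  then interpret S: separated_irreducible "operator_hemiring R M" "operator_semimodule M"
    by (intro separated_irreducible.intro left_semimodule_operators separated_irreducible_axioms.intro)
      (auto simp: operator_hemiring_simps(1) intro!: restrict_ext)
  show "hemiring (operator_hemiring R M)" "add_cancellative (operator_hemiring R M)"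
    "isomorphic_to_dense_subring (diff_ring (operator_hemiring R M))"
    by (rule hemiring_operator_hemiring S.add_cancellative_R S.diff_ring_dense)+
qed

text \<open>
  Faithfulness is exactly the condition on the zero fibre that a semiisomorphism needs; it does not
  make the map injective.
\<close>

lemma semiisomorphic_operator_hemiring:
  assumes "left_semimodule R M" "faithful R M"
  shows "semiisomorphic R (operator_hemiring R M)"
proof -
  interpret left_semimodule R M by fact
  show ?thesis
    unfolding semiisomorphic_def
  proof (rule bexI[of _ op], intro conjI)
    have "op r = \<zero>\<^bsub>operator_hemiring R M\<^esub> \<longleftrightarrow> (\<forall>m\<in>carrier M. r \<odot>\<^bsub>M\<^esub> m = \<zero>\<^bsub>M\<^esub>)" for r
      by (auto simp: operator_hemiring_def fun_eq_iff)
    then show "{r \<in> carrier R. op r = \<zero>\<^bsub>operator_hemiring R M\<^esub>} = {\<zero>\<^bsub>R\<^esub>}"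
      using assms(2) by (simp add: faithful_def)
    show "op \<in> hemiring_hom R (operator_hemiring R M)"
      unfolding hemiring_hom_def hom_def using operator_hemiring_simps by auto
  qed (simp add: operator_hemiring_simps)
qed

text \<open>
  The vector space itself, with \<open>s v\<close> given by the transformation that corresponds to \<open>s - 0\<close>, is
  faithful and irreducible over \<open>S\<close>.  For irreducibility, density at the one vector \<open>v - w\<close> yields
  an element \<open>r - s\<close> with \<open>(r - s)(v - w) = - m\<close>.
\<close>

lemma primitive_diff_dense:
  fixes S :: "('s, 'c) ring_scheme"
  assumes S: "hemiring S" "add_cancellative S" and rep: "isomorphic_to_dense_subring (diff_ring S)"
  shows "primitive S"
proof -
  interpret S: hemiring S by fact
  obtain D :: "('s \<times> 's) set ring" and V :: "(('s \<times> 's) set, ('s \<times> 's) set) module" and T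
    where vs: "right_vector_space D V" and nz: "carrier V \<noteq> {\<zero>\<^bsub>V\<^esub>}" and dense: "dense_subring D V T"
    and iso: "hemiring_isomorphic (diff_ring S) (End_ring D V \<lparr>carrier := T\<rparr>)"
    using rep unfolding isomorphic_to_dense_subring_def by blast
  interpret right_vector_space D V by fact
  obtain \<phi> where hom: "\<phi> \<in> hemiring_hom (diff_ring S) (End_ring D V \<lparr>carrier := T\<rparr>)"
    and bij: "bij_betw \<phi> (carrier (diff_ring S)) T"
    using iso unfolding hemiring_isomorphic_def by auto
  have TE: "T \<subseteq> carrier (End_ring D V)"
    using dense subgroup.subset unfolding dense_subring_def by fastforce
  have T_dense: "\<And>n v w. \<lbrakk>lin_independent D V n v; w \<in> {..<n} \<rightarrow> carrier V\<rbrakk>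
      \<Longrightarrow> \<exists>t\<in>T. \<forall>i<n. t (v i) = w i"
    using dense unfolding dense_subring_def by blast
  have \<phi>_add: "\<phi> (X \<oplus>\<^bsub>diff_ring S\<^esub> Y) = (\<lambda>v\<in>carrier V. \<phi> X v \<oplus>\<^bsub>V\<^esub> \<phi> Y v)"
    and \<phi>_mult: "\<phi> (X \<otimes>\<^bsub>diff_ring S\<^esub> Y) = (\<lambda>v\<in>carrier V. \<phi> X (\<phi> Y v))"
    if "X \<in> carrier (diff_ring S)" "Y \<in> carrier (diff_ring S)" for X Y
    using hom that by (auto simp: hemiring_hom_def hom_def End_ring_def)
  have \<phi>_zero: "\<phi> \<zero>\<^bsub>diff_ring S\<^esub> = (\<lambda>v\<in>carrier V. \<zero>\<^bsub>V\<^esub>)"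
    using hom by (auto simp: hemiring_hom_def End_ring_def)
  have \<phi>T: "\<phi> X \<in> T" if "X \<in> carrier (diff_ring S)" for X
    using bij that by (auto simp: bij_betw_def)
  have T_closed: "t v \<in> carrier V"
    and T_additive: "w \<in> carrier V \<Longrightarrow> t (v \<oplus>\<^bsub>V\<^esub> w) = t v \<oplus>\<^bsub>V\<^esub> t w"
    if "t \<in> T" "v \<in> carrier V" for t v w
    using that TE by (auto simp: End_ring_def)
  define \<iota> where "\<iota> s = diff_class S s \<zero>\<^bsub>S\<^esub>" for s
  have \<iota>_closed [simp]: "\<iota> s \<in> carrier (diff_ring S)" if "s \<in> carrier S" for s
    using that S.diff_class_carrier by (simp add: \<iota>_def)
  define act where "act s = \<phi> (\<iota> s)" for s
  have act_T: "act s \<in> T" if "s \<in> carrier S" for s using that \<phi>T by (simp add: act_def)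
  have act_closed [simp]: "act s v \<in> carrier V" if "s \<in> carrier S" "v \<in> carrier V" for s v
    using that act_T T_closed by blast
  have act_additive: "act s (v \<oplus>\<^bsub>V\<^esub> w) = act s v \<oplus>\<^bsub>V\<^esub> act s w"
    if "s \<in> carrier S" "v \<in> carrier V" "w \<in> carrier V" for s v w
    using that act_T T_additive by blast
  have act_vzero: "act s \<zero>\<^bsub>V\<^esub> = \<zero>\<^bsub>V\<^esub>" if "s \<in> carrier S" for s
    using act_additive[OF that V.zero_closed V.zero_closed] act_closed[OF that V.zero_closed]
    by (metis V.add.r_cancel_one' V.l_zero V.zero_closed)
  have act_add: "act (r \<oplus>\<^bsub>S\<^esub> s) v = act r v \<oplus>\<^bsub>V\<^esub> act s v"
    and act_mult: "act (r \<otimes>\<^bsub>S\<^esub> s) v = act r (act s v)"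
    if "r \<in> carrier S" "s \<in> carrier S" "v \<in> carrier V" for r s v
  proof -
    have "\<iota> (r \<oplus>\<^bsub>S\<^esub> s) = \<iota> r \<oplus>\<^bsub>diff_ring S\<^esub> \<iota> s"
      using that by (simp add: \<iota>_def S.diff_ring_add)
    then show "act (r \<oplus>\<^bsub>S\<^esub> s) v = act r v \<oplus>\<^bsub>V\<^esub> act s v"
      using \<phi>_add[of "\<iota> r" "\<iota> s"] that by (simp add: act_def)
    have "\<iota> (r \<otimes>\<^bsub>S\<^esub> s) = \<iota> r \<otimes>\<^bsub>diff_ring S\<^esub> \<iota> s"
      using that by (simp add: \<iota>_def S.diff_ring_mult S.m_closed S.l_null S.r_null)
    then show "act (r \<otimes>\<^bsub>S\<^esub> s) v = act r (act s v)"
      using \<phi>_mult[of "\<iota> r" "\<iota> s"] that by (simp add: act_def)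
  qed
  have act_zero: "act \<zero>\<^bsub>S\<^esub> = (\<lambda>v\<in>carrier V. \<zero>\<^bsub>V\<^esub>)"
    using \<phi>_zero by (simp add: act_def \<iota>_def S.diff_ring_zero)
  define M :: "('s, ('s \<times> 's) set) module" where
    "M = \<lparr>carrier = carrier V, mult = undefined, one = undefined, zero = \<zero>\<^bsub>V\<^esub>,
    add = add V, smult = act\<rparr>"
  have [simp]: "carrier M = carrier V" "\<zero>\<^bsub>M\<^esub> = \<zero>\<^bsub>V\<^esub>" "v \<oplus>\<^bsub>M\<^esub> w = v \<oplus>\<^bsub>V\<^esub> w" "s \<odot>\<^bsub>M\<^esub> v = act s v" for v w s
    by (simp_all add: M_def)
  have "left_semimodule S M"
    by (intro left_semimodule.intro S.hemiring_axioms abelian_monoidI left_semimodule_axioms.intro)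
      (auto simp: V.a_ac act_add act_mult act_additive act_vzero act_zero)
  moreover have "add_cancellative M"
    by (simp add: add_cancellative_def)
  moreover have "\<exists>r\<in>carrier S. \<exists>s\<in>carrier S.
      m \<oplus>\<^bsub>V\<^esub> act r v \<oplus>\<^bsub>V\<^esub> act s w = act r w \<oplus>\<^bsub>V\<^esub> act s v"
    if v: "v \<in> carrier V" "w \<in> carrier V" "m \<in> carrier V" "v \<noteq> w" for v w m
  proof -
    let ?u = "v \<oplus>\<^bsub>V\<^esub> \<ominus>\<^bsub>V\<^esub> w"
    have u: "?u \<in> carrier V" using v by simp
    have "?u \<noteq> \<zero>\<^bsub>V\<^esub>"
    proof
      assume "?u = \<zero>\<^bsub>V\<^esub>"
      moreover have "v = ?u \<oplus>\<^bsub>V\<^esub> w" using v by (simp add: V.a_assoc V.l_neg)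
      ultimately show False using v by simp
    qed
    then obtain t where t: "t \<in> T" "t ?u = \<ominus>\<^bsub>V\<^esub> m"
      using T_dense[OF lin_independent_single[OF u], of "\<lambda>_. \<ominus>\<^bsub>V\<^esub> m"] v(3) by auto
    obtain X where X: "X \<in> carrier (diff_ring S)" "t = \<phi> X" 
      using bij t(1) by (auto simp: bij_betw_def)
    obtain r s where rs: "r \<in> carrier S" "s \<in> carrier S" "X = diff_class S r s"
      by (rule S.diff_ring_cases[OF X(1)])
    have "X \<oplus>\<^bsub>diff_ring S\<^esub> \<iota> s = \<iota> r"
      using rs by (simp add: \<iota>_def S.diff_ring_add S.diff_class_eq_iff_cancel[OF S(2)])
    then have "act r ?u = t ?u \<oplus>\<^bsub>V\<^esub> act s ?u"
      using \<phi>_add[of X "\<iota> s"] X rs(1,2) u by (simp add: act_def)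
    then have eq: "m \<oplus>\<^bsub>V\<^esub> act r ?u = act s ?u"
      using t(2) v rs(1,2) u by (simp add: V.a_assoc[symmetric] V.r_neg)
    have "m \<oplus>\<^bsub>V\<^esub> act r v \<oplus>\<^bsub>V\<^esub> act s w = (m \<oplus>\<^bsub>V\<^esub> act r ?u) \<oplus>\<^bsub>V\<^esub> (act r w \<oplus>\<^bsub>V\<^esub> act s w)"
    proof -
      have "act r v = act r ?u \<oplus>\<^bsub>V\<^esub> act r w"
        using act_additive[OF rs(1) u v(2)] v by (simp add: V.a_assoc V.l_neg)
      then show ?thesis using v rs(1,2) u by (simp add: V.a_ac)
    qed
    also have "\<dots> = act r w \<oplus>\<^bsub>V\<^esub> (act s ?u \<oplus>\<^bsub>V\<^esub> act s w)"
      unfolding eq using v rs(1,2) u by (simp add: V.a_ac)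
    also have "act s ?u \<oplus>\<^bsub>V\<^esub> act s w = act s v"
      using act_additive[OF rs(2) u v(2)] v by (simp add: V.a_assoc V.l_neg)
    finally show ?thesis using rs(1,2) by blast
  qed
  ultimately have "irreducible_semimodule S M"
    using nz unfolding irreducible_semimodule_def by simp
  moreover have "faithful S M"
  proof -
    have "s = \<zero>\<^bsub>S\<^esub>" if s: "s \<in> carrier S" "\<forall>v\<in>carrier V. act s v = \<zero>\<^bsub>V\<^esub>" for s
    proof -
      have "act s \<in> carrier (End_ring D V)" using act_T[OF s(1)] TE by blast
      then have "act s = (\<lambda>v\<in>carrier V. \<zero>\<^bsub>V\<^esub>)"
        using s(2) by (auto simp: End_ring_def fun_eq_iff PiE_iff extensional_def)
      then have "\<phi> (\<iota> s) = \<phi> (\<iota> \<zero>\<^bsub>S\<^esub>)" using act_zero by (simp add: act_def)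
      then have "\<iota> s = \<iota> \<zero>\<^bsub>S\<^esub>" using bij s(1) by (auto simp: bij_betw_def dest: inj_onD)
      then show ?thesis using s(1) by (simp add: \<iota>_def S.diff_class_eq_iff_cancel[OF S(2)])
    qed
    then show ?thesis by (auto simp: faithful_def act_zero)
  qed
  ultimately show ?thesis by (rule primitiveI)
qed

lemma primitive_if_semiisomorphic:
  fixes R :: "('a, 'c) ring_scheme" and S :: "('s, 'd) ring_scheme"
  assumes R: "hemiring R" and semi: "semiisomorphic R S" and prim: "primitive S"
  shows "primitive R"
proof -
  interpret R: hemiring R by fact
  obtain f where f: "f \<in> hemiring_hom R S" "f ` carrier R = carrier S"
    and ker: "{a \<in> carrier R. f a = \<zero>\<^bsub>S\<^esub>} = {\<zero>\<^bsub>R\<^esub>}"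
    using semi unfolding semiisomorphic_def by blast
  obtain M :: "('s, 's \<times> 's) module" where irr: "irreducible_semimodule S M" and faith: "faithful S M"
    using prim unfolding primitive_def by blast
  interpret left_semimodule S M using irr by (simp add: irreducible_semimodule_def)
  define N :: "('a, 's \<times> 's) module" where
    "N = \<lparr>carrier = carrier M, mult = undefined, one = undefined, zero = \<zero>\<^bsub>M\<^esub>,
    add = add M, smult = (\<lambda>r m. f r \<odot>\<^bsub>M\<^esub> m)\<rparr>"
  have N [simp]: "carrier N = carrier M" "\<zero>\<^bsub>N\<^esub> = \<zero>\<^bsub>M\<^esub>" "v \<oplus>\<^bsub>N\<^esub> w = v \<oplus>\<^bsub>M\<^esub> w"
    "s \<odot>\<^bsub>N\<^esub> v = f s \<odot>\<^bsub>M\<^esub> v" for v w s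
    by (simp_all add: N_def)
  have f_closed: "f r \<in> carrier S" if "r \<in> carrier R" for r using f(2) that by blast
  have "left_semimodule R N"
    using f(1) f_closed
    by (intro left_semimodule.intro R abelian_monoidI left_semimodule_axioms.intro)
      (auto simp: M.a_ac hemiring_hom_def hom_def smult_closed smult_assoc smult_r_distr
        smult_l_distr smult_r_null smult_l_null)
  moreover have "\<exists>r1\<in>carrier R. \<exists>r2\<in>carrier R.
      m \<oplus>\<^bsub>M\<^esub> f r1 \<odot>\<^bsub>M\<^esub> v \<oplus>\<^bsub>M\<^esub> f r2 \<odot>\<^bsub>M\<^esub> w = f r1 \<odot>\<^bsub>M\<^esub> w \<oplus>\<^bsub>M\<^esub> f r2 \<odot>\<^bsub>M\<^esub> v"
    if "v \<in> carrier M" "w \<in> carrier M" "m \<in> carrier M" "v \<noteq> w" for v w m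
  proof -
    have "\<exists>s1\<in>carrier S. \<exists>s2\<in>carrier S.
        m \<oplus>\<^bsub>M\<^esub> s1 \<odot>\<^bsub>M\<^esub> v \<oplus>\<^bsub>M\<^esub> s2 \<odot>\<^bsub>M\<^esub> w = s1 \<odot>\<^bsub>M\<^esub> w \<oplus>\<^bsub>M\<^esub> s2 \<odot>\<^bsub>M\<^esub> v"
      using irr that by (simp add: irreducible_semimodule_def)
    then show ?thesis unfolding f(2)[symmetric] by (simp only: bex_simps(7))
  qed
  ultimately have "irreducible_semimodule R N"
    using irr by (simp add: irreducible_semimodule_def add_cancellative_def)
  moreover have "faithful R N"
  proof -
    have "(\<forall>m\<in>carrier M. f r \<odot>\<^bsub>M\<^esub> m = \<zero>\<^bsub>M\<^esub>) \<longleftrightarrow> f r = \<zero>\<^bsub>S\<^esub>" if "r \<in> carrier R" for r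
      using faith f_closed[OF that] unfolding faithful_def by blast
    then have "{r \<in> carrier R. \<forall>m\<in>carrier N. r \<odot>\<^bsub>N\<^esub> m = \<zero>\<^bsub>N\<^esub>} = {a \<in> carrier R. f a = \<zero>\<^bsub>S\<^esub>}"
      by auto
    then show ?thesis using ker by (simp add: faithful_def)
  qed
  ultimately show ?thesis by (rule primitiveI)
qed

theorem theorem4p5:
  fixes R :: "('a, 'c) ring_scheme"
  assumes "hemiring R"
  shows "primitive R \<longleftrightarrow>
    (\<exists>S :: 'a ring. hemiring S \<and> add_cancellative S \<and> semiisomorphic R S \<and>
      isomorphic_to_dense_subring (diff_ring S))"
proof
  assume "primitive R"
  then obtain M :: "('a, 'a \<times> 'a) module" where M: "irreducible_semimodule R M" "faithful R M"
    unfolding primitive_def by blast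
  then have "semiisomorphic R (operator_hemiring R M)"
    by (intro semiisomorphic_operator_hemiring) (simp_all add: irreducible_semimodule_def)
  then show "\<exists>S :: 'a ring. hemiring S \<and> add_cancellative S \<and> semiisomorphic R S \<and>
      isomorphic_to_dense_subring (diff_ring S)"
    using operator_hemiring_dense[OF M(1)] by (intro semiisomorphic_witness)
next
  assume "\<exists>S :: 'a ring. hemiring S \<and> add_cancellative S \<and> semiisomorphic R S \<and>
      isomorphic_to_dense_subring (diff_ring S)"
  then show "primitive R"
    using primitive_diff_dense primitive_if_semiisomorphic[OF assms] by blast
qed

end
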